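(* For any finite group $G$, the minimal number of irreducible components for a faithful complex representation of $G$ is bounded above by $\lambda(G)$.
   Context: For a finite group $G$ and a subgroup $H$, $[H,G]$ denotes the lattice of all subgroups $K$ with $H \subseteq K \subseteq G$. Its bottom interval is $[H,B]$, where $B$ is the join of all the atoms of $[H,G]$; $[H,G]$ is bottom Boolean if $[H,B]$ is a Boolean lattice, i.e. isomorphic to the lattice of subsets of a finite set. The dual Euler totient is $\hat{\varphi}(H,G) := \sum_{K \in [H,G]} \mu(H,K)\,|G:K|$, with $\mu$ the Möbius function of the lattice $[H,G]$. $\lambda(H,G)$ is the minimal length $n$ of an ordered chain of subgroups $H = H_0 \subseteq H_1 \subseteq \dots \subseteq H_n = G$ such that, for each $i = 1,\dots,n$, the interval $[H_{i-1},H_i]$ is bottom Boolean and $\hat{\varphi}(H_{i-1},H_i)$ is nonzero. One writes $\lambda(G) := \lambda(1,G)$. The number of irreducible components is counted with multiplicity, and the zero representation (with zero components) is allowed. *)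

theory Defs
  imports
    "HOL-Algebra.Coset"
    "HOL-Algebra.Lattice"
    "Jordan_Normal_Form.VS_Connect"
begin

section \<open>Intervals of subgroups\<close>

definition subgroup_interval :: "'a set \<Rightarrow> ('a, 'b) monoid_scheme \<Rightarrow> 'a set set" where
  "subgroup_interval H G = {K. subgroup K G \<and> H \<subseteq> K}"

definition subgroup_lattice :: "'a set \<Rightarrow> ('a, 'b) monoid_scheme \<Rightarrow> 'a set gorder" where
  "subgroup_lattice H G = \<lparr>carrier = subgroup_interval H G, eq = (=), le = (\<subseteq>)\<rparr>"

definition interval_atoms :: "'a set \<Rightarrow> ('a, 'b) monoid_scheme \<Rightarrow> 'a set set" where
  "interval_atoms H G = {A \<in> subgroup_interval H G.
     H \<subset> A \<and> (\<nexists>K. K \<in> subgroup_interval H G \<and> H \<subset> K \<and> K \<subset> A)}"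

text \<open>For \<open>H = G\<close> there are no atoms and the join is the bottom element \<open>H\<close>.\<close>

definition atom_join :: "'a set \<Rightarrow> ('a, 'b) monoid_scheme \<Rightarrow> 'a set" where
  "atom_join H G = \<Squnion>\<^bsub>subgroup_lattice H G\<^esub> (interval_atoms H G)"

text \<open>An order isomorphism between lattices is the same as a lattice isomorphism. Up to
  isomorphism every finite set is a finite set of natural numbers.\<close>

definition boolean_interval :: "'a set \<Rightarrow> ('a, 'b) monoid_scheme \<Rightarrow> bool" where
  "boolean_interval H G \<longleftrightarrow> (\<exists>(S :: nat set) f. finite S \<and>
     bij_betw f (subgroup_interval H G) (Pow S) \<and>
     (\<forall>K \<in> subgroup_interval H G. \<forall>L \<in> subgroup_interval H G. K \<subseteq> L \<longleftrightarrow> f K \<subseteq> f L))"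

definition bottom_boolean :: "'a set \<Rightarrow> ('a, 'b) monoid_scheme \<Rightarrow> bool" where
  "bottom_boolean H G \<longleftrightarrow> boolean_interval H (G\<lparr>carrier := atom_join H G\<rparr>)"


section \<open>The dual Euler totient\<close>

text \<open>The Moebius function of a finite poset \<open>P\<close> with the order of its type; the finiteness
  test only serves termination.\<close>

function moebius :: "'a::order set \<Rightarrow> 'a \<Rightarrow> 'a \<Rightarrow> int" where
  "moebius P a b =
     (if finite P \<and> a < b then - (\<Sum>c \<in> {c \<in> P. a \<le> c \<and> c < b}. moebius P a c)
      else if a = b then 1 else 0)"
  by pat_completeness auto
termination
proof (relation "Wellfounded.measure (\<lambda>(P, a, b). card {z \<in> P. z < b})", goal_cases)
  case 1
  show ?case by simp
next
  case (2 P a b c)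
  then have "{z \<in> P. z < c} \<subset> {z \<in> P. z < b}"
    by auto
  moreover have "finite {z \<in> P. z < b}"
    using 2 by simp
  ultimately show ?case
    by (simp add: psubset_card_mono)
qed

declare moebius.simps [simp del]

definition dual_totient :: "'a set \<Rightarrow> ('a, 'b) monoid_scheme \<Rightarrow> int" where
  "dual_totient H G =
     (\<Sum>K \<in> subgroup_interval H G.
        moebius (subgroup_interval H G) H K * int (card (rcosets\<^bsub>G\<^esub> K)))"


section \<open>The length \<open>\<lambda>(H, G)\<close>\<close>

definition totient_chain ::
  "'a set \<Rightarrow> ('a, 'b) monoid_scheme \<Rightarrow> nat \<Rightarrow> (nat \<Rightarrow> 'a set) \<Rightarrow> bool" where
  "totient_chain H G n C \<longleftrightarrow>
     C 0 = H \<and> C n = carrier G \<and> (\<forall>i \<le> n. subgroup (C i) G) \<and>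
     (\<forall>i \<in> {1..n}. C (i - 1) \<subseteq> C i \<and>
        bottom_boolean (C (i - 1)) (G\<lparr>carrier := C i\<rparr>) \<and>
        dual_totient (C (i - 1)) (G\<lparr>carrier := C i\<rparr>) \<noteq> 0)"

text \<open>Such chains exist for finite \<open>G\<close>: if \<open>K\<close> is maximal in \<open>L\<close>, then \<open>[K, L]\<close> is Boolean of
  rank 1 with dual totient \<open>|L : K| - 1\<close>.\<close>

definition chain_length :: "'a set \<Rightarrow> ('a, 'b) monoid_scheme \<Rightarrow> nat" where
  "chain_length H G = (LEAST n. \<exists>C. totient_chain H G n C)"


section \<open>Complex representations\<close>

text \<open>A representation on \<open>\<complex>\<^sup>n\<close> is a homomorphism into the group of invertible matrices;
  \<open>n = 0\<close> gives the zero representation.\<close>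

definition complex_representation ::
  "('a, 'b) monoid_scheme \<Rightarrow> nat \<Rightarrow> ('a \<Rightarrow> complex mat) \<Rightarrow> bool" where
  "complex_representation G n \<rho> \<longleftrightarrow> \<rho> \<in> hom G (units_of (ring_mat TYPE(complex) n ()))"

definition faithful_representation ::
  "('a, 'b) monoid_scheme \<Rightarrow> nat \<Rightarrow> ('a \<Rightarrow> complex mat) \<Rightarrow> bool" where
  "faithful_representation G n \<rho> \<longleftrightarrow>
     complex_representation G n \<rho> \<and> inj_on \<rho> (carrier G)"

definition subrepresentation ::
  "('a, 'b) monoid_scheme \<Rightarrow> nat \<Rightarrow> ('a \<Rightarrow> complex mat) \<Rightarrow> complex vec set \<Rightarrow> bool" where
  "subrepresentation G n \<rho> W \<longleftrightarrow>
     subspace class_ring W (module_vec TYPE(complex) n) \<and>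
     (\<forall>g \<in> carrier G. \<forall>w \<in> W. \<rho> g *\<^sub>v w \<in> W)"

definition irreducible_subrepresentation ::
  "('a, 'b) monoid_scheme \<Rightarrow> nat \<Rightarrow> ('a \<Rightarrow> complex mat) \<Rightarrow> complex vec set \<Rightarrow> bool" where
  "irreducible_subrepresentation G n \<rho> W \<longleftrightarrow>
     subrepresentation G n \<rho> W \<and> W \<noteq> {0\<^sub>v n} \<and>
     (\<forall>U. subrepresentation G n \<rho> U \<and> U \<subseteq> W \<longrightarrow> U = {0\<^sub>v n} \<or> U = W)"

text \<open>\<open>\<complex>\<^sup>n\<close> is the internal direct sum of the subspaces \<open>W 0, \<dots>, W (k - 1)\<close>: every vector
  is a sum of \<open>w i \<in> W i\<close> in exactly one way.\<close>

definition direct_sum_of :: "nat \<Rightarrow> nat \<Rightarrow> (nat \<Rightarrow> complex vec set) \<Rightarrow> bool" where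
  "direct_sum_of n k W \<longleftrightarrow>
     bij_betw (\<lambda>w. \<Oplus>\<^bsub>module_vec TYPE(complex) n\<^esub> i \<in> {..<k}. w i)
       (\<Pi>\<^sub>E i \<in> {..<k}. W i) (carrier_vec n)"

text \<open>Isomorphic summands are listed separately, so \<open>k\<close> counts the irreducible components with
  multiplicity.\<close>

definition has_irreducible_components ::
  "('a, 'b) monoid_scheme \<Rightarrow> nat \<Rightarrow> ('a \<Rightarrow> complex mat) \<Rightarrow> nat \<Rightarrow> bool" where
  "has_irreducible_components G n \<rho> k \<longleftrightarrow>
     (\<exists>W. (\<forall>i < k. irreducible_subrepresentation G n \<rho> (W i)) \<and> direct_sum_of n k W)"

text \<open>The set is nonempty for finite \<open>G\<close>: the regular representation is faithful and, by
  Maschke, a direct sum of irreducible subrepresentations.\<close>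

definition min_faithful_components :: "('a, 'b) monoid_scheme \<Rightarrow> nat" where
  "min_faithful_components G =
     (LEAST k. \<exists>n \<rho>. faithful_representation G n \<rho> \<and> has_irreducible_components G n \<rho> k)"

end

theory Submission
  imports Defs "Jordan_Normal_Form.DL_Rank"
begin

text \<open>Let \<open>\<chi>\<close> be the character of the regular representation of \<open>G\<close>. Its average over a subgroup
  \<open>M\<close> is \<open>|G : M|\<close>, so for a link \<open>L \<subseteq> K\<close> of the chain the sum of \<open>\<mu>(L, M)\<close> times the average of
  \<open>\<chi>\<close> over \<open>M\<close>, taken over \<open>M \<in> [L, K]\<close>, is \<open>|G : K|\<close> times the dual totient of \<open>[L, K]\<close>, hence
  nonzero. As \<open>\<chi>\<close> is a sum of irreducible characters of \<open>G\<close>, the same sum is nonzero for some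
  irreducible \<open>\<sigma>\<close>. Suppose some \<open>k \<in> K - L\<close> satisfied \<open>\<sigma>(k) = 1\<close>. The average of the character of
  \<open>\<sigma>\<close> over \<open>M\<close> depends only on the image \<open>\<sigma>(M)\<close>, so it is invariant under the closure operator
  \<open>M \<mapsto> {k \<in> K. \<sigma>(k) \<in> \<sigma>(M)}\<close> on \<open>[L, K]\<close>, which moves \<open>L\<close>; by Rota's closure theorem the sum would
  vanish. Thus the kernel of \<open>\<sigma>\<close> meets \<open>K\<close> inside \<open>L\<close>. Choosing one such \<open>\<sigma>\<close> for every link, an
  element in the kernel of their direct sum descends along the chain from \<open>G\<close> to the trivial
  subgroup.\<close>

section \<open>Moebius sums and averages over subgroups\<close>

lemma moebius_self: "moebius P a a = 1"
  by (subst moebius.simps) simp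

lemma sum_moebius_atMost:
  assumes "finite P" "a \<in> P" "b \<in> P" "a < b"
  shows "(\<Sum>x \<in> {x \<in> P. a \<le> x \<and> x \<le> b}. moebius P a x) = 0"
proof -
  have "{x \<in> P. a \<le> x \<and> x \<le> b} = insert b {x \<in> P. a \<le> x \<and> x < b}"
    using assms by (auto simp: order.order_iff_strict)
  then show ?thesis
    using assms by (simp add: moebius.simps[of P a b])
qed

text \<open>The fibre over a non-closed \<open>d\<close> is empty. For a closed \<open>d\<close>,
  the vanishing Moebius sum over the interval from \<open>a\<close> to \<open>d\<close> splits into
  the closure fibres over the elements below \<open>d\<close>; the fibres over smaller elements
  vanish by induction, which leaves the one over \<open>d\<close>.\<close>

lemma sum_moebius_closure_fibre:
  fixes P :: "'a::order set"
  assumes P: "finite P" "a \<in> P" "\<And>x. x \<in> P \<Longrightarrow> a \<le> x"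
    and cl: "\<And>x. x \<in> P \<Longrightarrow> cl x \<in> P" "\<And>x. x \<in> P \<Longrightarrow> x \<le> cl x"
      "\<And>x y. x \<in> P \<Longrightarrow> y \<in> P \<Longrightarrow> x \<le> y \<Longrightarrow> cl x \<le> cl y" "\<And>x. x \<in> P \<Longrightarrow> cl (cl x) = cl x"
    and "cl a \<noteq> a" "d \<in> P"
  shows "(\<Sum>x \<in> {x \<in> P. cl x = d}. moebius P a x) = 0"
  using \<open>d \<in> P\<close>
proof (induction "card {x \<in> P. x < d}" arbitrary: d rule: less_induct)
  case less
  show ?case
  proof (cases "cl d = d")
    case False
    then have "{x \<in> P. cl x = d} = {}"
      using cl(4) by auto
    then show ?thesis
      by (simp only: sum.empty)
  next
    case True
    \<comment> \<open>Here \<open>cl a \<noteq> a\<close> enters: the closed element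
      \<open>d\<close> cannot be \<open>a\<close>, and only for endpoints strictly above
      \<open>a\<close> does the Moebius sum vanish.\<close>
    have "a < d"
      using True P(2,3) less.prems cl(1,2) \<open>cl a \<noteq> a\<close> by (metis order.not_eq_order_implies_strict)
    \<comment> \<open>For closed \<open>d\<close>, an element lies below \<open>d\<close> exactly
      when its closure does, so no fibre is cut in two.\<close>
    have below: "{x \<in> P. a \<le> x \<and> x \<le> d} = (\<Union>e \<in> {e \<in> P. e \<le> d}. {x \<in> P. cl x = e})"
    proof -
      have "x \<le> d \<longleftrightarrow> cl x \<le> d" if "x \<in> P" for x
        using cl(2,3)[of x] True less.prems that by (metis order.trans)
      then show ?thesis
        using P(3) cl(1) by blast
    qed
    have "0 = (\<Sum>x \<in> {x \<in> P. a \<le> x \<and> x \<le> d}. moebius P a x)"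
      using sum_moebius_atMost[OF P(1,2) less.prems \<open>a < d\<close>] by (rule sym)
    also have "\<dots> = (\<Sum>e \<in> {e \<in> P. e \<le> d}. \<Sum>x \<in> {x \<in> P. cl x = e}. moebius P a x)"
      unfolding below using P by (intro sum.UNION_disjoint) auto
    also have "{e \<in> P. e \<le> d} = insert d {e \<in> P. e < d}"
      using less.prems by (auto simp: order.order_iff_strict)
    also have "(\<Sum>e \<in> insert d {e \<in> P. e < d}. \<Sum>x \<in> {x \<in> P. cl x = e}. moebius P a x) =
        (\<Sum>x \<in> {x \<in> P. cl x = d}. moebius P a x)
        + (\<Sum>e \<in> {e \<in> P. e < d}. \<Sum>x \<in> {x \<in> P. cl x = e}. moebius P a x)"
      using P by simp
    also have "(\<Sum>e \<in> {e \<in> P. e < d}. \<Sum>x \<in> {x \<in> P. cl x = e}. moebius P a x) = 0"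
    proof (rule sum.neutral, rule ballI)
      fix e
      assume e: "e \<in> {e \<in> P. e < d}"
      then have "{x \<in> P. x < e} \<subset> {x \<in> P. x < d}"
        by auto
      then have "card {x \<in> P. x < e} < card {x \<in> P. x < d}"
        using P by (simp add: psubset_card_mono)
      then show "(\<Sum>x \<in> {x \<in> P. cl x = e}. moebius P a x) = 0"
        using less.hyps e by blast
    qed
    finally show ?thesis
      by simp
  qed
qed

text \<open>Invariance makes \<open>f\<close> constant on the fibres of \<open>cl\<close>, so it
  factors out of each fibre sum and a pure Moebius sum remains.\<close>

lemma sum_moebius_closure_invariant:
  fixes P :: "'a::order set" and f :: "'a \<Rightarrow> 'b::comm_ring_1"
  assumes P: "finite P" "a \<in> P" "\<And>x. x \<in> P \<Longrightarrow> a \<le> x"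
    and cl: "\<And>x. x \<in> P \<Longrightarrow> cl x \<in> P" "\<And>x. x \<in> P \<Longrightarrow> x \<le> cl x"
      "\<And>x y. x \<in> P \<Longrightarrow> y \<in> P \<Longrightarrow> x \<le> y \<Longrightarrow> cl x \<le> cl y" "\<And>x. x \<in> P \<Longrightarrow> cl (cl x) = cl x"
    and "cl a \<noteq> a" "\<And>x. x \<in> P \<Longrightarrow> f (cl x) = f x"
  shows "(\<Sum>x \<in> P. of_int (moebius P a x) * f x) = 0"
proof -
  have "(\<Sum>x \<in> P. of_int (moebius P a x) * f x) =
      (\<Sum>d \<in> cl ` P. \<Sum>x \<in> {x \<in> P. cl x = d}. of_int (moebius P a x) * f x)"
    using P(1) by (rule sum.image_gen)
  also have "\<dots> = (\<Sum>d \<in> cl ` P. of_int (\<Sum>x \<in> {x \<in> P. cl x = d}. moebius P a x) * f d)"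
    unfolding of_int_sum sum_distrib_right
    by (intro sum.cong refl) (use assms(9) in \<open>metis (mono_tags, lifting) imageE mem_Collect_eq\<close>)
  also have "\<dots> = 0"
  proof (rule sum.neutral, rule ballI)
    fix d
    assume "d \<in> cl ` P"
    then have "d \<in> P"
      using cl(1) by auto
    then have "(\<Sum>x \<in> {x \<in> P. cl x = d}. moebius P a x) = 0"
      using sum_moebius_closure_fibre[of P a cl d] assms(1-8) by blast
    then show "of_int (\<Sum>x \<in> {x \<in> P. cl x = d}. moebius P a x) * f d = 0"
      by simp
  qed
  finally show ?thesis .
qed

section \<open>Averages over subgroups and kernels of homomorphisms\<close>

text \<open>The fibres of \<open>\<rho>\<close> on \<open>M\<close> are cosets of its kernel in
  \<open>M\<close>, so they share one size, which cancels from numerator and denominator. The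
  average thus depends on the image of \<open>M\<close> alone.\<close>

lemma average_hom_image:
  fixes G (structure) and F :: "'c \<Rightarrow> complex"
  assumes "group G" "group H" "\<rho> \<in> hom G H" "subgroup M G" "finite M"
  shows "(\<Sum>m \<in> M. F (\<rho> m)) / of_nat (card M) = (\<Sum>x \<in> \<rho> ` M. F x) / of_nat (card (\<rho> ` M))"
proof -
  interpret group_hom G H \<rho>
    using assms by (simp add: group_hom_def group_hom_axioms_def)
  interpret M: subgroup M G by fact
  define k where "k = card {m \<in> M. \<rho> m = \<one>\<^bsub>H\<^esub>}"
  have fibre: "card {m \<in> M. \<rho> m = x} = k" if x: "x \<in> \<rho> ` M" for x
  proof -
    obtain m0 where m0: "m0 \<in> M" "x = \<rho> m0"
      using x by auto
    \<comment> \<open>Left translation by \<open>m0\<close> carries the kernel onto the fibre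
      through \<open>m0\<close>.\<close>
    have "bij_betw (\<lambda>m. m0 \<otimes> m) {m \<in> M. \<rho> m = \<one>\<^bsub>H\<^esub>} {m \<in> M. \<rho> m = x}"
      by (rule bij_betw_byWitness[where f' = "\<lambda>m. inv m0 \<otimes> m"])
        (use m0 in \<open>auto simp: M.mem_carrier simp flip: G.m_assoc\<close>)
    then show ?thesis
      unfolding k_def by (rule bij_betw_same_card[symmetric])
  qed
  have "of_nat k \<noteq> (0::complex)"
  proof -
    have "\<one> \<in> {m \<in> M. \<rho> m = \<one>\<^bsub>H\<^esub>}"
      by simp
    then have "{m \<in> M. \<rho> m = \<one>\<^bsub>H\<^esub>} \<noteq> {}"
      by blast
    then show ?thesis
      using assms(5) by (simp add: k_def)
  qed
  have sums: "(\<Sum>m \<in> M. f (\<rho> m)) = of_nat k * (\<Sum>x \<in> \<rho> ` M. f x)" for f :: "'c \<Rightarrow> complex"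
  proof -
    have "(\<Sum>m \<in> M. f (\<rho> m)) = (\<Sum>x \<in> \<rho> ` M. \<Sum>m \<in> {m \<in> M. \<rho> m = x}. f (\<rho> m))"
      using assms(5) by (rule sum.image_gen)
    also have "\<dots> = (\<Sum>x \<in> \<rho> ` M. of_nat k * f x)"
      by (intro sum.cong refl) (simp add: fibre)
    finally show ?thesis
      by (simp add: sum_distrib_left)
  qed
  have "of_nat (card M) = of_nat k * (of_nat (card (\<rho> ` M)) :: complex)"
    using sums[of "\<lambda>_. 1"] by simp
  with sums[of F] \<open>of_nat k \<noteq> 0\<close> show ?thesis
    by simp
qed

lemma subgroup_interval_restrict:
  assumes "group G" "subgroup K G"
  shows "subgroup_interval L (G\<lparr>carrier := K\<rparr>) = {M. subgroup M G \<and> L \<subseteq> M \<and> M \<subseteq> K}"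
proof -
  interpret group G by fact
  have "subgroup M (G\<lparr>carrier := K\<rparr>) \<longleftrightarrow> subgroup M G \<and> M \<subseteq> K" for M
    using assms(2) incl_subgroup[OF assms(2), of M] subgroup_incl[of M K]
      subgroup.subset[of M "G\<lparr>carrier := K\<rparr>"] by auto
  then show ?thesis
    by (auto simp: subgroup_interval_def)
qed

text \<open>A kernel element \<open>k\<close> of \<open>K\<close> outside \<open>L\<close> makes the
  closure induced by \<open>\<rho>\<close> move the bottom \<open>L\<close>, while the averages over
  \<open>M\<close> and over its closure agree; the weighted sum would be zero. The function
  \<open>F\<close> will later be the trace.\<close>

lemma kernel_subset_bottom:
  fixes G (structure) and F :: "'c \<Rightarrow> complex"
  assumes "group G" "group H" "\<rho> \<in> hom G H" "subgroup L G" "subgroup K G" "L \<subseteq> K" "finite K"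
    and nonzero: "(\<Sum>M \<in> subgroup_interval L (G\<lparr>carrier := K\<rparr>).
       of_int (moebius (subgroup_interval L (G\<lparr>carrier := K\<rparr>)) L M)
         * ((\<Sum>m \<in> M. F (\<rho> m)) / of_nat (card M))) \<noteq> 0"
    and k: "k \<in> K" "\<rho> k = \<one>\<^bsub>H\<^esub>"
  shows "k \<in> L"
proof (rule ccontr)
  assume "k \<notin> L"
  interpret group_hom G H \<rho>
    using assms by (simp add: group_hom_def group_hom_axioms_def)
  interpret K: subgroup K G by fact
  define P where "P = subgroup_interval L (G\<lparr>carrier := K\<rparr>)"
  have P_eq: "P = {M. subgroup M G \<and> L \<subseteq> M \<and> M \<subseteq> K}"
    unfolding P_def using assms by (intro subgroup_interval_restrict)
  \<comment> \<open>For a subgroup \<open>M\<close> of \<open>K\<close> this is \<open>M\<close>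
    times the part of the kernel of \<open>\<rho>\<close> inside \<open>K\<close>, the largest
    subgroup of \<open>K\<close> with the same image as \<open>M\<close>.\<close>
  define cl where "cl M = {k \<in> K. \<rho> k \<in> \<rho> ` M}" for M
  have subgroup_cl: "subgroup (cl M) G" if "subgroup M G" for M
  proof -
    interpret M: subgroup M G by fact
    show ?thesis
    proof
      fix x y
      assume "x \<in> cl M" "y \<in> cl M"
      then obtain m m' where "x \<in> K" "y \<in> K" "m \<in> M" "m' \<in> M" "\<rho> x = \<rho> m" "\<rho> y = \<rho> m'"
        by (auto simp: cl_def)
      then show "x \<otimes> y \<in> cl M"
        unfolding cl_def by (auto intro!: image_eqI[of _ _ "m \<otimes> m'"])
    next
      fix x
      assume "x \<in> cl M"
      then obtain m where "x \<in> K" "m \<in> M" "\<rho> x = \<rho> m"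
        by (auto simp: cl_def)
      then show "inv x \<in> cl M"
        unfolding cl_def by (auto intro!: image_eqI[of _ _ "inv m"])
    qed (auto simp: cl_def intro!: image_eqI[of _ _ \<one>])
  qed
  \<comment> \<open>Unchanged images give both the idempotence of \<open>cl\<close> and the
    invariance of the averages.\<close>
  have image_cl: "\<rho> ` cl M = \<rho> ` M" if "M \<in> P" for M
    using that by (auto simp: P_eq cl_def)
  have "(\<Sum>M \<in> P. of_int (moebius P L M) * ((\<Sum>m \<in> M. F (\<rho> m)) / of_nat (card M))) = 0"
  proof (rule sum_moebius_closure_invariant[where cl = cl])
    show "finite P"
      using assms(7) by (auto simp: P_eq intro: finite_subset[of _ "Pow K"])
    show "L \<in> P"
      using assms by (simp add: P_eq)
    have "k \<in> cl L"
      using k subgroup.one_closed[OF assms(4)] by (auto simp: cl_def intro!: image_eqI[of _ _ \<one>])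
    then show "cl L \<noteq> L"
      using \<open>k \<notin> L\<close> by auto
    fix M
    assume M: "M \<in> P"
    then show "L \<subseteq> M" "cl M \<in> P" "M \<subseteq> cl M"
      using subgroup_cl by (auto simp: P_eq cl_def)
    show "cl (cl M) = cl M"
      unfolding cl_def[of "cl M"] image_cl[OF M] by (simp add: cl_def)
    have "subgroup M G" "finite M" "subgroup (cl M) G" "finite (cl M)"
      using M assms(7) finite_subset subgroup_cl by (auto simp: P_eq cl_def)
    then show "(\<Sum>m \<in> cl M. F (\<rho> m)) / of_nat (card (cl M)) = (\<Sum>m \<in> M. F (\<rho> m)) / of_nat (card M)"
      using average_hom_image[OF assms(1-3)] by (simp add: image_cl[OF M])
  qed (auto simp: cl_def)
  then show False
    using nonzero by (simp add: P_def)
qed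

text \<open>By Lagrange \<open>|G| / |M|\<close> is \<open>|G : K|\<close> times
  \<open>|K : M|\<close>, and the constant factor \<open>|G : K|\<close> leaves the sum. The
  quotient \<open>|G| / |M|\<close> will arise as the average of the regular character over
  \<open>M\<close>.\<close>

lemma sum_moebius_index:
  assumes "group G" "finite (carrier G)" "subgroup L G" "subgroup K G"
  shows "(\<Sum>M \<in> subgroup_interval L (G\<lparr>carrier := K\<rparr>).
       of_int (moebius (subgroup_interval L (G\<lparr>carrier := K\<rparr>)) L M)
         * (of_nat (card (carrier G)) / of_nat (card M))) =
     of_nat (card (carrier G)) / of_nat (card K) * (of_int (dual_totient L (G\<lparr>carrier := K\<rparr>)) :: complex)"
proof -
  interpret group G by fact
  interpret K: group "G\<lparr>carrier := K\<rparr>"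
    using assms(4) by (rule subgroup_imp_group)
  have fin: "finite K"
    using assms subgroup.subset finite_subset by blast
  have "of_nat (card (carrier G)) / of_nat (card M) =
      of_nat (card (carrier G)) / of_nat (card K) * (of_nat (card (rcosets\<^bsub>G\<lparr>carrier := K\<rparr>\<^esub> M)) :: complex)"
    if "M \<in> subgroup_interval L (G\<lparr>carrier := K\<rparr>)" for M
  proof -
    have M: "subgroup M (G\<lparr>carrier := K\<rparr>)"
      using that by (simp add: subgroup_interval_def)
    have "card (rcosets\<^bsub>G\<lparr>carrier := K\<rparr>\<^esub> M) * card M = card K"
      using K.lagrange[OF M] by (simp add: Coset.order_def)
    moreover have "card K \<noteq> 0"
      using fin subgroup.one_closed[OF assms(4)] by auto
    ultimately have "of_nat (card K) = (of_nat (card (rcosets\<^bsub>G\<lparr>carrier := K\<rparr>\<^esub> M)) * of_nat (card M) :: complex)"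
      "of_nat (card K) \<noteq> (0 :: complex)"
      by (metis of_nat_mult, simp)
    then show ?thesis
      by simp
  qed
  then show ?thesis
    unfolding dual_totient_def by (simp add: sum_distrib_left mult_ac)
qed

section \<open>Existence of chains\<close>

text \<open>The interval collapses to \<open>{L, K}\<close> with single atom \<open>K\<close> and
  Moebius values 1 and -1, so the dual totient is \<open>|K : L| - 1\<close>, which is nonzero as
  \<open>L\<close> is proper.\<close>

lemma (in group) maximal_subgroup_link:
  assumes "finite (carrier G)" "subgroup L G" "subgroup K G" "L \<subset> K"
    and maximal: "\<And>M. subgroup M G \<Longrightarrow> L \<subseteq> M \<Longrightarrow> M \<subseteq> K \<Longrightarrow> M = L \<or> M = K"
  shows "bottom_boolean L (G\<lparr>carrier := K\<rparr>)" and "dual_totient L (G\<lparr>carrier := K\<rparr>) \<noteq> 0"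
proof -
  have I: "subgroup_interval L (G\<lparr>carrier := K\<rparr>) = {L, K}"
    using subgroup_interval_restrict[OF is_group assms(3), of L] assms maximal by auto
  have atoms: "interval_atoms L (G\<lparr>carrier := K\<rparr>) = {K}"
    unfolding interval_atoms_def I using assms(4) by auto
  have "atom_join L (G\<lparr>carrier := K\<rparr>) = K"
  proof -
    have "least (subgroup_lattice L (G\<lparr>carrier := K\<rparr>)) x
        (Upper (subgroup_lattice L (G\<lparr>carrier := K\<rparr>)) {K}) \<longleftrightarrow> x = K" for x
      using assms(4) unfolding subgroup_lattice_def I least_def Upper_def by auto
    then show ?thesis
      unfolding atom_join_def atoms Lattice.sup_def by simp
  qed
  moreover have "boolean_interval L (G\<lparr>carrier := K\<rparr>)"
    unfolding boolean_interval_def I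
  proof (intro exI conjI)
    let ?f = "\<lambda>M. if M = K then {0 :: nat} else {}"
    have "Pow {0 :: nat} = {{}, {0}}"
      by auto
    then show "bij_betw ?f {L, K} (Pow {0 :: nat})"
      using assms(4) by (auto simp: bij_betw_def inj_on_def)
    show "\<forall>M \<in> {L, K}. \<forall>N \<in> {L, K}. M \<subseteq> N \<longleftrightarrow> ?f M \<subseteq> ?f N"
      using assms(4) by auto
  qed simp
  ultimately show "bottom_boolean L (G\<lparr>carrier := K\<rparr>)"
    by (simp add: bottom_boolean_def)
  have "finite K"
    by (rule finite_subset[OF subgroup.subset[OF assms(3)] assms(1)])
  interpret K: group "G\<lparr>carrier := K\<rparr>"
    using assms(3) by (rule subgroup_imp_group)
  have lagrange_K: "card (rcosets\<^bsub>G\<lparr>carrier := K\<rparr>\<^esub> M) * card M = card K" if "M \<in> {L, K}" for M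
    using K.lagrange[of M] that I by (auto simp: Coset.order_def subgroup_interval_def)
  have "moebius {L, K} L K = - 1"
  proof -
    have "{c \<in> {L, K}. L \<le> c \<and> c < K} = {L}"
      using assms(4) by auto
    then show ?thesis
      using assms(4) by (subst moebius.simps) (simp add: moebius_self)
  qed
  moreover have "card (rcosets\<^bsub>G\<lparr>carrier := K\<rparr>\<^esub> K) = 1"
    using lagrange_K[of K] \<open>finite K\<close> assms(4) by auto
  moreover have "card (rcosets\<^bsub>G\<lparr>carrier := K\<rparr>\<^esub> L) \<noteq> 1"
    using lagrange_K[of L] psubset_card_mono[OF \<open>finite K\<close> assms(4)] by auto
  ultimately show "dual_totient L (G\<lparr>carrier := K\<rparr>) \<noteq> 0"
    using assms(4) by (simp add: dual_totient_def I moebius_self)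
qed

text \<open>Guarantees that the \<open>LEAST\<close> in \<open>chain_length\<close> is attained.
  Each link goes from a subgroup down to a maximal proper subgroup of it.\<close>

lemma (in group) totient_chain_exists:
  assumes "finite (carrier G)"
  shows "\<exists>n C. totient_chain {\<one>} G n C"
proof -
  define link where "link L K \<longleftrightarrow> L \<subseteq> K \<and> bottom_boolean L (G\<lparr>carrier := K\<rparr>) \<and>
    dual_totient L (G\<lparr>carrier := K\<rparr>) \<noteq> 0" for L K
  have "\<exists>(n :: nat) C. C 0 = {\<one>} \<and> C n = K \<and> (\<forall>i \<le> n. subgroup (C i) G) \<and> (\<forall>i \<in> {1..n}. link (C (i - 1)) (C i))"
    if "subgroup K G" for K
    using that
  proof (induction "card K" arbitrary: K rule: less_induct)
    case less
    have "finite K"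
      by (rule finite_subset[OF subgroup.subset[OF less.prems] assms])
    show ?case
    proof (cases "K = {\<one>}")
      case True
      then show ?thesis
        using less.prems by (intro exI[of _ 0] exI[of _ "\<lambda>_. K"]) simp
    next
      case False
      define P where "P = {L. subgroup L G \<and> L \<subset> K}"
      have "{\<one>} \<in> P"
        using False subgroup.one_closed[OF less.prems] by (auto simp: P_def triv_subgroup)
      moreover have "finite P"
        using \<open>finite K\<close> by (auto simp: P_def intro: finite_subset[of _ "Pow K"])
      ultimately obtain L where L: "L \<in> P" "\<And>M. M \<in> P \<Longrightarrow> L \<subseteq> M \<Longrightarrow> L = M"
        using finite_has_maximal[of P] by blast
      then have sub: "subgroup L G" "L \<subset> K"
        by (auto simp: P_def)
      have "M = L \<or> M = K" if "subgroup M G" "L \<subseteq> M" "M \<subseteq> K" for M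
        using L(2)[of M] that by (auto simp: P_def)
      then have "link L K"
        unfolding link_def
        using maximal_subgroup_link[OF assms sub(1) less.prems sub(2)] sub(2) by blast
      obtain n :: nat and C where C: "C 0 = {\<one>}" "C n = L" "\<forall>i \<le> n. subgroup (C i) G"
        "\<forall>i \<in> {1..n}. link (C (i - 1)) (C i)"
        using less.hyps[OF psubset_card_mono[OF \<open>finite K\<close> sub(2)] sub(1)] by blast
      show ?thesis
        \<comment> \<open>The chain ending in \<open>L\<close> is kept and \<open>K\<close> is
          placed at the new last index.\<close>
        using C \<open>link L K\<close> less.prems
        by (intro exI[of _ "Suc n"] exI[of _ "C(Suc n := K)"]) (auto simp: le_Suc_eq)
    qed
  qed
  from this[OF subgroup_self] show ?thesis
    unfolding totient_chain_def link_def by blast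
qed

section \<open>Characters as sums of irreducible characters\<close>

definition mat_trace :: "'a::comm_monoid_add mat \<Rightarrow> 'a" where
  "mat_trace A = (\<Sum>i < dim_row A. A $$ (i, i))"

lemma mat_trace_comm:
  fixes A B :: "'a::comm_semiring_0 mat"
  assumes "A \<in> carrier_mat n m" "B \<in> carrier_mat m n"
  shows "mat_trace (A * B) = mat_trace (B * A)"
proof -
  have "mat_trace (A * B) = (\<Sum>i < n. \<Sum>j < m. A $$ (i, j) * B $$ (j, i))"
    using assms by (simp add: mat_trace_def scalar_prod_def atLeast0LessThan)
  also have "\<dots> = (\<Sum>j < m. \<Sum>i < n. B $$ (j, i) * A $$ (i, j))"
    by (subst sum.swap) (simp add: mult.commute)
  also have "\<dots> = mat_trace (B * A)"
    using assms by (simp add: mat_trace_def scalar_prod_def atLeast0LessThan)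
  finally show ?thesis .
qed

lemma mat_trace_four_block:
  fixes A :: "'a::comm_monoid_add mat"
  assumes "A \<in> carrier_mat n n" "D \<in> carrier_mat m m"
  shows "mat_trace (four_block_mat A B C D) = mat_trace A + mat_trace D"
proof -
  have "mat_trace (four_block_mat A B C D) = (\<Sum>i < n + m. if i < n then A $$ (i, i) else D $$ (i - n, i - n))"
    using assms by (auto simp: mat_trace_def intro!: sum.cong)
  also have "{..<n + m} = {..<n} \<union> {n..<n + m}"
    by auto
  also have "(\<Sum>i \<in> \<dots>. if i < n then A $$ (i, i) else D $$ (i - n, i - n)) =
      (\<Sum>i < n. A $$ (i, i)) + (\<Sum>i = n..<n + m. D $$ (i - n, i - n))"
    by (subst sum.union_disjoint) auto
  also have "(\<Sum>i = n..<n + m. D $$ (i - n, i - n)) = (\<Sum>i < m. D $$ (i, i))"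
    using sum.shift_bounds_nat_ivl[of "\<lambda>i. D $$ (i - n, i - n)" 0 n m]
    by (simp add: atLeast0LessThan add.commute)
  finally show ?thesis
    using assms by (simp add: mat_trace_def)
qed

section \<open>Bases adapted to a subspace\<close>

lemma subspace_module_vec_iff:
  "subspace (class_ring :: 'a::field ring) W (module_vec TYPE('a) n) \<longleftrightarrow>
    W \<subseteq> carrier_vec n \<and> 0\<^sub>v n \<in> W \<and> (\<forall>v \<in> W. \<forall>w \<in> W. v + w \<in> W) \<and> (\<forall>c. \<forall>v \<in> W. c \<cdot>\<^sub>v v \<in> W)"
proof -
  have "Module.module (class_ring :: 'a ring) (module_vec TYPE('a) n)"
    by (rule vec_module)
  then show ?thesis
    using vec_vs[of n]
    by (auto simp: subspace_def submodule_def module_vec_simps)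
qed

text \<open>Independent sets have at most \<open>n\<close> elements, so there is a maximal one
  between \<open>A\<close> and \<open>U\<close>; a vector of \<open>U\<close> outside its span could
  still be added to it.\<close>

lemma (in vec_space) extend_lin_indpt:
  assumes "A \<subseteq> U" "U \<subseteq> carrier_vec n" "lin_indpt A"
  obtains B where "A \<subseteq> B" "B \<subseteq> U" "lin_indpt B" "finite B" "U \<subseteq> span B"
proof -
  have "finite C \<and> card C \<le> n" if "C \<subseteq> U" "lin_indpt C" for C
    using li_le_dim[of C] that assms(2) dim_is_n by auto
  then obtain B where B: "finite B" "maximal B (\<lambda>B. A \<subseteq> B \<and> B \<subseteq> U \<and> lin_indpt B)"
    using maximal_exists[of "\<lambda>B. A \<subseteq> B \<and> B \<subseteq> U \<and> lin_indpt B" n A] assms by blast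
  then have B_U: "A \<subseteq> B" "B \<subseteq> U" "lin_indpt B"
    by (auto simp: maximal_def)
  have "U \<subseteq> span B"
  proof (rule subsetI, rule ccontr)
    fix u
    assume u: "u \<in> U" "u \<notin> span B"
    have "B \<subseteq> carrier_vec n" "u \<in> carrier_vec n"
      using B_U assms(2) u by auto
    then have "u \<notin> B" "lin_indpt (insert u B)"
      using lin_dep_iff_in_span[of B u] in_own_span[of B] B_U(3) u(2) by auto
    moreover have "A \<subseteq> insert u B" "insert u B \<subseteq> U" "B \<subseteq> insert u B"
      using B_U u by auto
    ultimately have "insert u B = B"
      using B(2) unfolding maximal_def by blast
    with \<open>u \<notin> B\<close> show False
      by blast
  qed
  with B(1) B_U that show thesis
    by blast
qed

text \<open>The columns of \<open>S\<close> are a basis of \<open>U\<close>, followed by its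
  extension to a basis of the whole space, and \<open>T\<close> is the inverse of \<open>S\<close>.
  In these coordinates matrices that preserve \<open>U\<close> become block triangular.\<close>

lemma adapted_basis:
  fixes U :: "'a::field vec set"
  assumes "subspace class_ring U (module_vec TYPE('a) n)"
  obtains S T :: "'a mat" and r where "S \<in> carrier_mat n n" "T \<in> carrier_mat n n"
    "S * T = 1\<^sub>m n" "T * S = 1\<^sub>m n" "r \<le> n"
    "\<And>v. v \<in> carrier_vec n \<Longrightarrow> S *\<^sub>v v \<in> U \<longleftrightarrow> (\<forall>j. r \<le> j \<and> j < n \<longrightarrow> v $ j = 0)"
proof -
  interpret vec_space "TYPE('a)" n .
  have U: "U \<subseteq> carrier_vec n"
    using assms unfolding subspace_module_vec_iff by auto
  have "lin_indpt {}"
    by (auto simp: lin_dep_def)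
  obtain A where A: "A \<subseteq> U" "lin_indpt A" "finite A" "U \<subseteq> span A"
    by (rule extend_lin_indpt[OF empty_subsetI U \<open>lin_indpt {}\<close>])
  obtain B where B: "A \<subseteq> B" "B \<subseteq> carrier_vec n" "lin_indpt B" "finite B" "carrier_vec n \<subseteq> span B"
    by (rule extend_lin_indpt[OF subset_trans[OF A(1) U] subset_refl A(2)])
  then have "basis B"
    unfolding basis_def using span_closed by auto
  then have card_B: "card B = n"
    using dim_basis[of B] B(4) dim_is_n by simp
  have span_A: "span A = U"
    using A(1,4) assms span_is_subset[of A U] by (auto simp: subspace_def)
  obtain as where as: "set as = A" "distinct as"
    using A(3) finite_distinct_list by blast
  obtain bs where bs: "set bs = B - A" "distinct bs"
    using B(4) finite_distinct_list[of "B - A"] by blast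
  have dist: "distinct (as @ bs)" and set_B: "set (as @ bs) = B"
    using as bs B(1) by auto
  have len: "length (as @ bs) = n"
    using dist set_B card_B distinct_card by metis
  define r where "r = length as"
  define S where "S = mat_of_cols n (as @ bs)"
  have S: "S \<in> carrier_mat n n"
    using len unfolding S_def by (metis mat_of_cols_carrier(1))
  have cols_S: "cols S = as @ bs"
    unfolding S_def using set_B B(2) by (intro cols_mat_of_cols) auto
  have col_S: "col S i = (as @ bs) ! i" if "i < n" for i
    using that S cols_S by (metis carrier_matD(2) cols_nth)
  have col_A: "col S i \<in> A \<longleftrightarrow> i < r" if "i < n" for i
  proof (cases "i < r")
    case True
    then show ?thesis
      using that as by (auto simp: col_S r_def nth_append)
  next
    case False
    then have "i - r < length bs"
      using that len by (simp add: r_def)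
    then have "bs ! (i - r) \<in> B - A"
      using bs nth_mem by blast
    then show ?thesis
      using that False by (simp add: col_S r_def nth_append)
  qed
  have "rank S = n"
    using lin_indpt_full_rank[of S n] S dist B(3) set_B unfolding cols_S by blast
  then have det: "det S \<noteq> 0"
    using det_rank_iff[OF S] by simp
  then obtain T where T: "T \<in> carrier_mat n n" "S * T = 1\<^sub>m n" "T * S = 1\<^sub>m n"
    using det_non_zero_imp_unit[OF S det, of "()"] by (auto simp: Units_def ring_mat_simps)
  \<comment> \<open>Membership in \<open>U\<close> amounts to vanishing coefficients on the added
    basis vectors \<open>B - A\<close>.\<close>
  have clean: "lincomb a B = lincomb a A" if "\<And>x. x \<in> B - A \<Longrightarrow> a x = 0" for a
  proof -
    have "A \<subseteq> carrier_vec n" "B - A \<subseteq> carrier_vec n" "finite (B - A)" "a \<in> B - A \<rightarrow> {0}" "A \<union> (B - A) = B"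
      using that A(1) U B by auto
    with lincomb_clean[of A "B - A" a] A(3) show ?thesis
      by simp
  qed
  have coords: "S *\<^sub>v vec n (\<lambda>i. a (col S i)) = lincomb a B" for a
    using mat_mult_eq_lincomb[OF S, of a] dist set_B unfolding cols_S by simp
  have "S *\<^sub>v v \<in> U \<longleftrightarrow> (\<forall>j. r \<le> j \<and> j < n \<longrightarrow> v $ j = 0)" if v: "v \<in> carrier_vec n" for v
  proof
    assume "S *\<^sub>v v \<in> U"
    then obtain a where a: "S *\<^sub>v v = lincomb a A"
      using finite_span[of A] A U span_A by auto
    \<comment> \<open>Extending the coefficients by zero from \<open>A\<close> to \<open>B\<close>
      makes them comparable with the entries of \<open>v\<close>; cancelling \<open>S\<close> shows
      that they coincide.\<close>
    define b where "b x = (if x \<in> A then a x else 0)" for x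
    have "lincomb b B = lincomb b A"
      by (intro clean) (auto simp: b_def)
    also have "lincomb b A = lincomb a A"
      using A U by (intro lincomb_restrict) (auto simp: b_def)
    finally have "S *\<^sub>v vec n (\<lambda>i. b (col S i)) = S *\<^sub>v v"
      using a coords by simp
    then have "(T * S) *\<^sub>v vec n (\<lambda>i. b (col S i)) = (T * S) *\<^sub>v v"
      using S T(1) v by (simp add: assoc_mult_mat_vec[of _ n n _ n])
    then have "vec n (\<lambda>i. b (col S i)) = v"
      using T v by simp
    then show "\<forall>j. r \<le> j \<and> j < n \<longrightarrow> v $ j = 0"
      using col_A by (auto simp: b_def)
  next
    assume v0: "\<forall>j. r \<le> j \<and> j < n \<longrightarrow> v $ j = 0"
    \<comment> \<open>\<open>find_first\<close> returns the position of a column. The columns are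
      distinct, so column \<open>i\<close> receives the coefficient \<open>v $ i\<close>.\<close>
    define a where "a = (\<lambda>x. v $ find_first x (cols S))"
    have Sv: "S *\<^sub>v v = lincomb a B"
      using lincomb_eq_mat_mult[OF S v] dist set_B unfolding a_def cols_S by simp
    have "a (col S i) = v $ i" if "i < n" for i
      using that dist len find_first_unique[of "as @ bs" i] unfolding a_def cols_S by (simp add: col_S)
    moreover have "\<exists>i < n. x = col S i" if "x \<in> B" for x
      using that set_B len col_S by (metis in_set_conv_nth)
    ultimately have "lincomb a B = lincomb a A"
      using v0 col_A by (intro clean) (metis Diff_iff not_le)
    also have "\<dots> \<in> span A"
      using finite_span[of A] A U by auto
    finally show "S *\<^sub>v v \<in> U"
      using Sv span_A by simp
  qed
  then show thesis
    using that[of S T r] S T len by (simp add: r_def)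
qed

section \<open>Matrix representations and the splitting of characters\<close>

text \<open>Invertibility is implicit on the right: multiplicativity and the value at
  \<open>\<one>\<close> make \<open>\<rho> (inv g)\<close> a two-sided inverse of
  \<open>\<rho> g\<close>.\<close>

lemma (in group) complex_representation_iff:
  "complex_representation G n \<rho> \<longleftrightarrow>
    (\<forall>g \<in> carrier G. \<rho> g \<in> carrier_mat n n) \<and>
    (\<forall>g \<in> carrier G. \<forall>h \<in> carrier G. \<rho> (g \<otimes> h) = \<rho> g * \<rho> h) \<and> \<rho> \<one> = 1\<^sub>m n"
proof
  let ?R = "ring_mat TYPE(complex) n ()"
  assume "complex_representation G n \<rho>"
  then have hom: "\<rho> \<in> hom G (units_of ?R)"
    by (simp add: complex_representation_def)
  have "group (units_of ?R)"
    using ring_mat[where n = n and b = "()"] by (intro monoid.units_group) (rule ring.is_monoid)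
  then interpret group_hom G "units_of ?R" \<rho>
    using hom is_group by (simp add: group_hom_def group_hom_axioms_def)
  have "\<rho> g \<in> carrier_mat n n" if "g \<in> carrier G" for g
    using hom_closed[OF that] by (auto simp: units_of_def Units_def ring_mat_simps)
  then show "(\<forall>g \<in> carrier G. \<rho> g \<in> carrier_mat n n) \<and>
    (\<forall>g \<in> carrier G. \<forall>h \<in> carrier G. \<rho> (g \<otimes> h) = \<rho> g * \<rho> h) \<and> \<rho> \<one> = 1\<^sub>m n"
    using hom_mult hom_one by (simp add: units_of_def ring_mat_simps)
next
  assume \<rho>: "(\<forall>g \<in> carrier G. \<rho> g \<in> carrier_mat n n) \<and>
    (\<forall>g \<in> carrier G. \<forall>h \<in> carrier G. \<rho> (g \<otimes> h) = \<rho> g * \<rho> h) \<and> \<rho> \<one> = 1\<^sub>m n"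
  have "\<rho> g \<in> Units (ring_mat TYPE(complex) n ())" if g: "g \<in> carrier G" for g
  proof -
    have "\<rho> (inv g) * \<rho> g = 1\<^sub>m n" "\<rho> g * \<rho> (inv g) = 1\<^sub>m n"
      using \<rho> g inv_closed[OF g] l_inv[OF g] r_inv[OF g] by metis+
    then show ?thesis
      using \<rho> g by (auto simp: Units_def ring_mat_simps intro!: bexI[of _ "\<rho> (inv g)"])
  qed
  then show "complex_representation G n \<rho>"
    using \<rho> by (auto simp: complex_representation_def hom_def units_of_def ring_mat_simps)
qed

text \<open>Only the character is split, so a block triangular form suffices and Maschke's theorem is
  not needed.\<close>

lemma (in group) subrepresentation_splits_character:
  assumes "complex_representation G n \<rho>" "subrepresentation G n \<rho> U" "U \<noteq> {0\<^sub>v n}" "U \<noteq> carrier_vec n"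
  obtains r s \<sigma> \<tau> where "r < n" "s < n" "complex_representation G r \<sigma>" "complex_representation G s \<tau>"
    "\<And>g. g \<in> carrier G \<Longrightarrow> mat_trace (\<rho> g) = mat_trace (\<sigma> g) + mat_trace (\<tau> g)"
proof -
  have \<rho>: "\<And>g. g \<in> carrier G \<Longrightarrow> \<rho> g \<in> carrier_mat n n"
    "\<And>g h. g \<in> carrier G \<Longrightarrow> h \<in> carrier G \<Longrightarrow> \<rho> (g \<otimes> h) = \<rho> g * \<rho> h" "\<rho> \<one> = 1\<^sub>m n"
    using assms(1) unfolding complex_representation_iff by auto
  have sub: "subspace class_ring U (module_vec TYPE(complex) n)"
    and inv_U: "\<And>g u. g \<in> carrier G \<Longrightarrow> u \<in> U \<Longrightarrow> \<rho> g *\<^sub>v u \<in> U"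
    using assms(2) by (auto simp: subrepresentation_def)
  obtain S T r where S: "S \<in> carrier_mat n n" and T: "T \<in> carrier_mat n n"
    and ST: "S * T = 1\<^sub>m n" and TS: "T * S = 1\<^sub>m n" and "r \<le> n"
    and S_U: "\<And>v. v \<in> carrier_vec n \<Longrightarrow> S *\<^sub>v v \<in> U \<longleftrightarrow> (\<forall>j. r \<le> j \<and> j < n \<longrightarrow> v $ j = 0)"
    using adapted_basis[OF sub] by blast
  have STv: "S *\<^sub>v (T *\<^sub>v v) = v" if "v \<in> carrier_vec n" for v
    using that S T by (simp add: ST flip: assoc_mult_mat_vec)
  have U_sub: "U \<subseteq> carrier_vec n" "0\<^sub>v n \<in> U"
    using sub by (auto simp: subspace_module_vec_iff)
  \<comment> \<open>The extreme values of \<open>r\<close> would make \<open>U\<close> the whole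
    space or zero. Excluding both leaves two diagonal blocks of smaller degree.\<close>
  have "r \<noteq> n"
  proof
    assume "r = n"
    then have "v \<in> U" if "v \<in> carrier_vec n" for v
      using S_U[of "T *\<^sub>v v"] STv[OF that] T that by auto
    with U_sub assms(4) show False
      by blast
  qed
  have "r \<noteq> 0"
  proof
    assume "r = 0"
    have "u = 0\<^sub>v n" if "u \<in> U" for u
    proof -
      have u: "u \<in> carrier_vec n"
        using that U_sub by blast
      then have "T *\<^sub>v u = 0\<^sub>v n"
        using S_U[of "T *\<^sub>v u"] STv[OF u] T that \<open>r = 0\<close> by (intro eq_vecI) auto
      then show ?thesis
        using STv[OF u] S by auto
    qed
    with U_sub assms(3) show False
      by blast
  qed
  define M where "M g = T * \<rho> g * S" for g
  have M: "M g \<in> carrier_mat n n" if "g \<in> carrier G" for g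
    using S T \<rho>(1)[OF that] by (simp add: M_def)
  have M_mult: "M (g \<otimes> h) = M g * M h" if "g \<in> carrier G" "h \<in> carrier G" for g h
  proof -
    note c = S T \<rho>(1)[OF that(1)] \<rho>(1)[OF that(2)]
    have "M g * M h = T * \<rho> g * (S * T) * \<rho> h * S"
      using c by (simp add: M_def assoc_mult_mat[of _ n n _ n _ n])
    then show ?thesis
      using c that by (simp add: M_def ST \<rho>(2) assoc_mult_mat[of _ n n _ n _ n])
  qed
  have M_one: "M \<one> = 1\<^sub>m n"
    using T by (simp add: M_def \<rho>(3) TS)
  \<comment> \<open>\<open>S\<close> sends the unit vector with index \<open>j < r\<close> into
    \<open>U\<close>, invariance keeps its image there, and membership in \<open>U\<close> forces
    the coordinates from \<open>r\<close> on to vanish.\<close>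
  have M_zero: "M g $$ (i, j) = 0" if g: "g \<in> carrier G" and ij: "r \<le> i" "i < n" "j < r" for g i j
  proof -
    have j: "j < n"
      using ij(3) \<open>r \<le> n\<close> by simp
    have "S *\<^sub>v unit_vec n j \<in> U"
      using S_U[of "unit_vec n j"] ij(3) j by simp
    then have "\<rho> g *\<^sub>v (S *\<^sub>v unit_vec n j) \<in> U"
      using inv_U g by blast
    also have "\<rho> g *\<^sub>v (S *\<^sub>v unit_vec n j) = S *\<^sub>v (M g *\<^sub>v unit_vec n j)"
    proof -
      have "S * M g = S * T * (\<rho> g * S)"
        using S T \<rho>(1)[OF g] by (simp add: M_def assoc_mult_mat[of _ n n _ n _ n])
      then have "S * M g = \<rho> g * S"
        using S \<rho>(1)[OF g] by (simp add: ST)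
      then show ?thesis
        using S M[OF g] \<rho>(1)[OF g] assoc_mult_mat_vec[of _ n n _ n "unit_vec n j"] unit_vec_carrier
        by metis
    qed
    finally have "(M g *\<^sub>v unit_vec n j) $ i = 0"
      using S_U[of "M g *\<^sub>v unit_vec n j"] M[OF g] ij by simp
    then show ?thesis
      using M[OF g] ij j by simp
  qed
  define s where "s = n - r"
  have n: "n = r + s"
    using \<open>r \<le> n\<close> by (simp add: s_def)
  \<comment> \<open>In block upper triangular form, \<open>\<sigma>\<close> is the action on
    \<open>U\<close> and \<open>\<tau>\<close> the action on the quotient by
    \<open>U\<close>.\<close>
  define \<sigma> where "\<sigma> g = mat r r (\<lambda>(i, j). M g $$ (i, j))" for g
  define \<beta> where "\<beta> g = mat r s (\<lambda>(i, j). M g $$ (i, j + r))" for g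
  define \<tau> where "\<tau> g = mat s s (\<lambda>(i, j). M g $$ (i + r, j + r))" for g
  have c: "\<sigma> g \<in> carrier_mat r r" "\<beta> g \<in> carrier_mat r s" "\<tau> g \<in> carrier_mat s s" for g
    by (simp_all add: \<sigma>_def \<beta>_def \<tau>_def)
  have M_block: "M g = four_block_mat (\<sigma> g) (\<beta> g) (0\<^sub>m s r) (\<tau> g)" if "g \<in> carrier G" for g
    using M[OF that] M_zero[OF that] by (intro eq_matI) (auto simp: \<sigma>_def \<beta>_def \<tau>_def n)
  have M_mult_block: "M (g \<otimes> h) =
      four_block_mat (\<sigma> g * \<sigma> h) (\<sigma> g * \<beta> h + \<beta> g * \<tau> h) (0\<^sub>m s r) (\<tau> g * \<tau> h)"
    if "g \<in> carrier G" "h \<in> carrier G" for g h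
    unfolding M_mult[OF that] M_block[OF that(1)] M_block[OF that(2)]
    by (subst mult_four_block_mat[of _ r r _ s _ s _ _ r _ s])
      (simp_all add: c right_mult_zero_mat[OF c(2)] right_mult_zero_mat[OF c(3)]
        left_mult_zero_mat[OF c(1)] left_mult_zero_mat[OF c(2)]
        right_add_zero_mat[OF mult_carrier_mat[OF c(1) c(1)]]
        left_add_zero_mat[OF mult_carrier_mat[OF c(3) c(3)]])
  have "complex_representation G r \<sigma>"
    unfolding complex_representation_iff
  proof (intro conjI ballI)
    fix g h
    assume gh: "g \<in> carrier G" "h \<in> carrier G"
    show "\<sigma> (g \<otimes> h) = \<sigma> g * \<sigma> h"
      unfolding \<sigma>_def[of "g \<otimes> h"] M_mult_block[OF gh] using c by (intro eq_matI) (simp_all add: \<sigma>_def)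
  next
    show "\<sigma> \<one> = 1\<^sub>m r"
      by (intro eq_matI) (simp_all add: \<sigma>_def M_one n)
  qed (rule c)
  moreover have "complex_representation G s \<tau>"
    unfolding complex_representation_iff
  proof (intro conjI ballI)
    fix g h
    assume gh: "g \<in> carrier G" "h \<in> carrier G"
    show "\<tau> (g \<otimes> h) = \<tau> g * \<tau> h"
      unfolding \<tau>_def[of "g \<otimes> h"] M_mult_block[OF gh] using c by (intro eq_matI) (simp_all add: \<sigma>_def \<tau>_def)
  next
    show "\<tau> \<one> = 1\<^sub>m s"
      by (intro eq_matI) (simp_all add: \<tau>_def M_one n)
  qed (rule c)
  moreover have "mat_trace (\<rho> g) = mat_trace (\<sigma> g) + mat_trace (\<tau> g)" if g: "g \<in> carrier G" for g
  proof -
    have "mat_trace (M g) = mat_trace (\<rho> g * S * T)"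
      using S T \<rho>(1)[OF g] mat_trace_comm[of T n n "\<rho> g * S"]
      by (simp add: M_def assoc_mult_mat[of _ n n _ n _ n])
    also have "\<rho> g * S * T = \<rho> g"
      using S T \<rho>(1)[OF g] by (simp add: ST assoc_mult_mat[of _ n n _ n _ n])
    finally show ?thesis
      using mat_trace_four_block[OF c(1,3)] by (simp add: M_block[OF g])
  qed
  moreover have "r < n" "s < n"
    using n \<open>r \<noteq> 0\<close> \<open>r \<noteq> n\<close> by auto
  ultimately show thesis
    using that by blast
qed

text \<open>Strong induction on the degree: a proper nonzero subrepresentation replaces the
  character by two of smaller degree. The list collects composition factors with
  repetitions.\<close>

lemma (in group) character_sum_irreducibles:
  assumes "complex_representation G n \<rho>"
  shows "\<exists>xs. (\<forall>(d, \<sigma>) \<in> set xs. complex_representation G d \<sigma> \<and>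
        irreducible_subrepresentation G d \<sigma> (carrier_vec d)) \<and>
      (\<forall>g \<in> carrier G. mat_trace (\<rho> g) = (\<Sum>(d, \<sigma>) \<leftarrow> xs. mat_trace (\<sigma> g)))"
  using assms
proof (induction n arbitrary: \<rho> rule: less_induct)
  case (less n)
  have \<rho>: "\<And>g. g \<in> carrier G \<Longrightarrow> \<rho> g \<in> carrier_mat n n"
    using less.prems unfolding complex_representation_iff by auto
  have whole: "subrepresentation G n \<rho> (carrier_vec n)"
    using \<rho> by (auto simp: subrepresentation_def subspace_module_vec_iff intro!: mult_mat_vec_carrier)
  consider "n = 0" | "n > 0" "irreducible_subrepresentation G n \<rho> (carrier_vec n)" |
    "n > 0" "\<not> irreducible_subrepresentation G n \<rho> (carrier_vec n)"
    by blast
  then show ?case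
  proof cases
    \<comment> \<open>The zero space does not count as irreducible, so degree 0 yields the empty
      list.\<close>
    case 1
    then have "mat_trace (\<rho> g) = 0" if "g \<in> carrier G" for g
      using \<rho>[OF that] by (simp add: mat_trace_def)
    then show ?thesis
      by (intro exI[of _ "[]"]) simp
  next
    case 2
    then show ?thesis
      using less.prems by (intro exI[of _ "[(n, \<rho>)]"]) simp
  next
    case 3
    \<comment> \<open>The whole space is a nonzero subrepresentation, so irreducibility can only
      fail through a proper nonzero one.\<close>
    have "unit_vec n 0 \<in> carrier_vec n" "unit_vec n 0 \<noteq> (0\<^sub>v n :: complex vec)"
      using 3(1) by simp_all
    then have "carrier_vec n \<noteq> {0\<^sub>v n :: complex vec}"
      by blast
    with 3(2) whole obtain U where U: "subrepresentation G n \<rho> U" "U \<noteq> {0\<^sub>v n}" "U \<noteq> carrier_vec n"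
      by (auto simp: irreducible_subrepresentation_def)
    obtain r s \<sigma> \<tau> where *: "r < n" "s < n" "complex_representation G r \<sigma>" "complex_representation G s \<tau>"
      "\<And>g. g \<in> carrier G \<Longrightarrow> mat_trace (\<rho> g) = mat_trace (\<sigma> g) + mat_trace (\<tau> g)"
      using subrepresentation_splits_character[OF less.prems U] by blast
    obtain xs ys where "\<forall>(d, \<sigma>) \<in> set xs. complex_representation G d \<sigma> \<and>
        irreducible_subrepresentation G d \<sigma> (carrier_vec d)"
      "\<forall>g \<in> carrier G. mat_trace (\<sigma> g) = (\<Sum>(d, \<sigma>) \<leftarrow> xs. mat_trace (\<sigma> g))"
      "\<forall>(d, \<sigma>) \<in> set ys. complex_representation G d \<sigma> \<and>
        irreducible_subrepresentation G d \<sigma> (carrier_vec d)"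
      "\<forall>g \<in> carrier G. mat_trace (\<tau> g) = (\<Sum>(d, \<sigma>) \<leftarrow> ys. mat_trace (\<sigma> g))"
      using less.IH[OF *(1,3)] less.IH[OF *(2,4)] by blast
    then show ?thesis
      using *(5) by (intro exI[of _ "xs @ ys"]) auto
  qed
qed

text \<open>\<open>G\<close> permutes its own elements by left multiplication. The trace of a
  permutation matrix counts fixed points, and \<open>g \<otimes> x = x\<close> forces
  \<open>g = \<one>\<close>.\<close>

lemma (in group) regular_representation:
  assumes "finite (carrier G)"
  shows "\<exists>\<rho>. complex_representation G (card (carrier G)) \<rho> \<and>
    (\<forall>g \<in> carrier G. mat_trace (\<rho> g) = (if g = \<one> then of_nat (card (carrier G)) else 0))"
proof -
  define N where "N = card (carrier G)"
  obtain e where e: "bij_betw e {..<N} (carrier G)"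
    using ex_bij_betw_nat_finite[OF assms] unfolding N_def atLeast0LessThan by blast
  have e_closed: "e i \<in> carrier G" if "i < N" for i
    using e that by (auto simp: bij_betw_def)
  have e_inj: "e i = e j \<longleftrightarrow> i = j" if "i < N" "j < N" for i j
    using e that by (auto simp: bij_betw_def inj_on_def)
  define \<rho> :: "'a \<Rightarrow> complex mat" where
    "\<rho> g = mat N N (\<lambda>(i, j). if g \<otimes> e j = e i then 1 else 0)" for g
  have "complex_representation G N \<rho>"
    unfolding complex_representation_iff
  proof (intro conjI ballI)
    fix g h
    assume gh: "g \<in> carrier G" "h \<in> carrier G"
    show "\<rho> (g \<otimes> h) = \<rho> g * \<rho> h"
    proof (rule eq_matI)
      fix i j
      assume "i < dim_row (\<rho> g * \<rho> h)" "j < dim_col (\<rho> g * \<rho> h)"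
      then have ij: "i < N" "j < N"
        by (simp_all add: \<rho>_def)
      \<comment> \<open>The index \<open>k\<close> of \<open>h \<otimes> e j\<close> is the only one
        that contributes to the entry of the matrix product.\<close>
      have "h \<otimes> e j \<in> e ` {..<N}"
        using gh e_closed[OF ij(2)] e by (simp add: bij_betw_def)
      then obtain k where k: "k < N" "h \<otimes> e j = e k"
        by auto
      have "(\<rho> g * \<rho> h) $$ (i, j) =
          (\<Sum>l < N. (if g \<otimes> e l = e i then 1 else 0) * (if h \<otimes> e j = e l then 1 else 0))"
        using ij by (simp add: \<rho>_def scalar_prod_def atLeast0LessThan)
      also have "\<dots> = (\<Sum>l < N. if k = l then if g \<otimes> e l = e i then 1 else 0 else 0)"
        by (intro sum.cong refl) (auto simp: k e_inj)
      also have "\<dots> = (if g \<otimes> e k = e i then 1 else 0)"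
        using k(1) by simp
      also have "g \<otimes> e k = g \<otimes> h \<otimes> e j"
        using gh e_closed[OF ij(2)] by (simp add: m_assoc flip: k(2))
      finally show "\<rho> (g \<otimes> h) $$ (i, j) = (\<rho> g * \<rho> h) $$ (i, j)"
        using ij by (simp add: \<rho>_def)
    qed (simp_all add: \<rho>_def)
  next
    show "\<rho> \<one> = 1\<^sub>m N"
      by (intro eq_matI) (auto simp: \<rho>_def e_closed e_inj)
  qed (simp add: \<rho>_def)
  moreover have "mat_trace (\<rho> g) = (if g = \<one> then of_nat N else 0)" if g: "g \<in> carrier G" for g
  proof -
    have "mat_trace (\<rho> g) = (\<Sum>i < N. if g \<otimes> e i = e i then 1 else 0)"
      by (simp add: \<rho>_def mat_trace_def)
    also have "\<dots> = (\<Sum>i < N. if g = \<one> then 1 else 0)"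
      using g e_closed by (intro sum.cong refl) simp
    finally show ?thesis
      by simp
  qed
  ultimately show ?thesis
    unfolding N_def by blast
qed

section \<open>Direct sums of irreducible representations\<close>

text \<open>An equivariant injection identifies the subrepresentations of \<open>W\<close> with
  those of its image. This serves for embedding each summand into a direct sum by padding with
  zeros.\<close>

lemma irreducible_subrepresentation_image:
  assumes e: "\<And>v. v \<in> carrier_vec n \<Longrightarrow> e v \<in> carrier_vec N" "inj_on e (carrier_vec n)"
    "\<And>v w. v \<in> carrier_vec n \<Longrightarrow> w \<in> carrier_vec n \<Longrightarrow> e (v + w) = e v + e w"
    "\<And>c v. v \<in> carrier_vec n \<Longrightarrow> e (c \<cdot>\<^sub>v v) = c \<cdot>\<^sub>v e v"
    and \<rho>: "\<And>g. g \<in> carrier G \<Longrightarrow> \<rho> g \<in> carrier_mat n n"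
    and equivariant: "\<And>g v. g \<in> carrier G \<Longrightarrow> v \<in> carrier_vec n \<Longrightarrow> \<sigma> g *\<^sub>v e v = e (\<rho> g *\<^sub>v v)"
    and irr: "irreducible_subrepresentation G n \<rho> W"
  shows "irreducible_subrepresentation G N \<sigma> (e ` W)"
proof -
  have e0: "e (0\<^sub>v n) = 0\<^sub>v N"
  proof -
    have "e (0 \<cdot>\<^sub>v 0\<^sub>v n) = 0 \<cdot>\<^sub>v e (0\<^sub>v n)"
      using e(4) zero_carrier_vec by blast
    moreover have "0 \<cdot>\<^sub>v (0\<^sub>v n :: complex vec) = 0\<^sub>v n" "0 \<cdot>\<^sub>v e (0\<^sub>v n) = 0\<^sub>v N"
      using e(1)[of "0\<^sub>v n"] by auto
    ultimately show ?thesis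
      by simp
  qed
  have sub: "subrepresentation G n \<rho> W" and "W \<noteq> {0\<^sub>v n}"
    and minimal: "\<And>U. subrepresentation G n \<rho> U \<Longrightarrow> U \<subseteq> W \<Longrightarrow> U = {0\<^sub>v n} \<or> U = W"
    using irr by (simp_all add: irreducible_subrepresentation_def)
  have W: "W \<subseteq> carrier_vec n" "0\<^sub>v n \<in> W" "\<And>v w. v \<in> W \<Longrightarrow> w \<in> W \<Longrightarrow> v + w \<in> W"
    "\<And>c v. v \<in> W \<Longrightarrow> c \<cdot>\<^sub>v v \<in> W" "\<And>g v. g \<in> carrier G \<Longrightarrow> v \<in> W \<Longrightarrow> \<rho> g *\<^sub>v v \<in> W"
    using sub by (simp_all add: subrepresentation_def subspace_module_vec_iff)
  note W_carrier = subsetD[OF W(1)]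
  have "subrepresentation G N \<sigma> (e ` W)"
    unfolding subrepresentation_def subspace_module_vec_iff
  proof (intro conjI ballI allI)
    show "e ` W \<subseteq> carrier_vec N"
      using e(1) W(1) by auto
    show "0\<^sub>v N \<in> e ` W"
      using W(2) e0 by force
  next
    fix v w
    assume "v \<in> e ` W" "w \<in> e ` W"
    then show "v + w \<in> e ` W"
      by (auto simp: W_carrier W(3) simp flip: e(3))
  next
    fix c v
    assume "v \<in> e ` W"
    then show "c \<cdot>\<^sub>v v \<in> e ` W"
      by (auto simp: W_carrier W(4) simp flip: e(4))
  next
    fix g v
    assume "g \<in> carrier G" "v \<in> e ` W"
    then show "\<sigma> g *\<^sub>v v \<in> e ` W"
      by (auto simp: W_carrier W(5) equivariant)
  qed
  moreover have "e ` W \<noteq> {0\<^sub>v N}"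
  proof
    assume "e ` W = {0\<^sub>v N}"
    then have "e v = e (0\<^sub>v n)" if "v \<in> W" for v
      using that e0 by auto
    then have "v = 0\<^sub>v n" if "v \<in> W" for v
      using that W_carrier e(2) by (meson inj_onD zero_carrier_vec)
    with W(2) \<open>W \<noteq> {0\<^sub>v n}\<close> show False
      by blast
  qed
  moreover have "U = {0\<^sub>v N} \<or> U = e ` W" if U: "subrepresentation G N \<sigma> U" "U \<subseteq> e ` W" for U
  proof -
    have U': "0\<^sub>v N \<in> U" "\<And>v w. v \<in> U \<Longrightarrow> w \<in> U \<Longrightarrow> v + w \<in> U"
      "\<And>c v. v \<in> U \<Longrightarrow> c \<cdot>\<^sub>v v \<in> U" "\<And>g v. g \<in> carrier G \<Longrightarrow> v \<in> U \<Longrightarrow> \<sigma> g *\<^sub>v v \<in> U"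
      using U(1) by (simp_all add: subrepresentation_def subspace_module_vec_iff)
    \<comment> \<open>Minimality of \<open>W\<close> applies to the preimage of \<open>U\<close>,
      which determines \<open>U\<close> because \<open>U\<close> lies in the image of
      \<open>W\<close>.\<close>
    define X where "X = {v \<in> W. e v \<in> U}"
    have "subrepresentation G n \<rho> X"
      unfolding subrepresentation_def subspace_module_vec_iff
    proof (intro conjI ballI allI)
      show "X \<subseteq> carrier_vec n" "0\<^sub>v n \<in> X"
        using W(1,2) U'(1) e0 by (auto simp: X_def)
    next
      fix v w
      assume "v \<in> X" "w \<in> X"
      then show "v + w \<in> X"
        using U'(2) W(3) W_carrier e(3) by (simp add: X_def)
    next
      fix c v
      assume "v \<in> X"
      then show "c \<cdot>\<^sub>v v \<in> X"
        using U'(3) W(4) W_carrier e(4) by (simp add: X_def)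
    next
      fix g v
      assume g: "g \<in> carrier G" and "v \<in> X"
      then show "\<rho> g *\<^sub>v v \<in> X"
        using U'(4) W(5) W_carrier equivariant by (simp add: X_def flip: equivariant)
    qed
    then have "X = {0\<^sub>v n} \<or> X = W"
      using minimal by (auto simp: X_def)
    moreover have "U = e ` X"
      using U(2) by (auto simp: X_def)
    ultimately show ?thesis
      using e0 by auto
  qed
  ultimately show ?thesis
    unfolding irreducible_subrepresentation_def by blast
qed

section \<open>Padded vectors and direct sums\<close>

lemma append_vec_zero_add:
  fixes v w :: "'a::comm_monoid_add vec"
  assumes "v \<in> carrier_vec n" "w \<in> carrier_vec m"
  shows "v @\<^sub>v w = (v @\<^sub>v 0\<^sub>v m) + (0\<^sub>v n @\<^sub>v w)"
  using assms by (intro eq_vecI) auto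

lemma finsum_append_zero:
  fixes v :: "'b \<Rightarrow> 'a::field vec"
  assumes "finite I" "\<And>i. i \<in> I \<Longrightarrow> v i \<in> carrier_vec n"
  shows "(\<Oplus>\<^bsub>module_vec TYPE('a) (n + m)\<^esub> i \<in> I. v i @\<^sub>v 0\<^sub>v m) =
    (\<Oplus>\<^bsub>module_vec TYPE('a) n\<^esub> i \<in> I. v i) @\<^sub>v 0\<^sub>v m"
proof -
  interpret V: vec_space "TYPE('a)" n .
  interpret W: vec_space "TYPE('a)" "n + m" .
  show ?thesis
    using assms
  proof (induction I rule: finite_induct)
    case empty
    then show ?case
      by (simp add: V.M.finsum_empty W.M.finsum_empty append_vec_def) (intro eq_vecI; simp)
  next
    case (insert i I)
    have v: "v \<in> I \<rightarrow> carrier_vec n" "v i \<in> carrier_vec n"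
      and w: "(\<lambda>i. v i @\<^sub>v 0\<^sub>v m) \<in> I \<rightarrow> carrier_vec (n + m)" "v i @\<^sub>v 0\<^sub>v m \<in> carrier_vec (n + m)"
      using insert.prems by auto
    have "finsum V.V v I \<in> carrier_vec n"
      using v(1) by (rule V.M.finsum_closed)
    then have "(v i @\<^sub>v 0\<^sub>v m) + (finsum V.V v I @\<^sub>v 0\<^sub>v m) = (v i + finsum V.V v I) @\<^sub>v (0\<^sub>v m + 0\<^sub>v m)"
      using v(2) by (intro append_vec_add[of _ n _ _ m]) auto
    then show ?case
      using insert v w by (simp add: V.M.finsum_insert W.M.finsum_insert)
  qed
qed

text \<open>A family for the enlarged sum is a family for the old one plus a vector \<open>u\<close>
  of the new block, and its sum is the old sum with \<open>u\<close> appended. Unique decomposition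
  thus passes from the old sum to the new one.\<close>

lemma direct_sum_of_append:
  assumes "direct_sum_of n k W" "\<And>i. i < k \<Longrightarrow> W i \<subseteq> carrier_vec n"
  shows "direct_sum_of (n + m) (Suc k)
    (\<lambda>i. if i < k then (\<lambda>v. v @\<^sub>v 0\<^sub>v m) ` W i else (\<lambda>v. 0\<^sub>v n @\<^sub>v v) ` carrier_vec m)"
    (is "direct_sum_of _ _ ?W'")
proof -
  interpret V: vec_space "TYPE(complex)" n .
  interpret W: vec_space "TYPE(complex)" "n + m" .
  let ?D = "(\<Pi>\<^sub>E i \<in> {..<k}. W i)" and ?C = "carrier_vec m :: complex vec set"
  \<comment> \<open>The restriction to \<open>{..<Suc k}\<close> supplies the value
    \<open>undefined\<close> elsewhere that \<open>\<Pi>\<^sub>E\<close> demands.\<close>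
  define \<beta> where "\<beta> = (\<lambda>(w, u :: complex vec). \<lambda>i \<in> {..<Suc k}. if i < k then w i @\<^sub>v 0\<^sub>v m else 0\<^sub>v n @\<^sub>v u)"
  have inj0: "v = w" if "v @\<^sub>v 0\<^sub>v m = w @\<^sub>v (0\<^sub>v m :: complex vec)" "v \<in> carrier_vec n" "w \<in> carrier_vec n" for v w
    using that append_vec_eq[of v n w] by simp
  have bij_\<beta>: "bij_betw \<beta> (?D \<times> ?C) (\<Pi>\<^sub>E i \<in> {..<Suc k}. ?W' i)"
    unfolding bij_betw_def
  proof
    show "inj_on \<beta> (?D \<times> ?C)"
    proof (rule inj_onI, clarify)
      fix w u w' u'
      assume w: "w \<in> ?D" "w' \<in> ?D" and u: "u \<in> ?C" "u' \<in> ?C" and eq: "\<beta> (w, u) = \<beta> (w', u')"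
      have "w i = w' i" if "i < k" for i
      proof (rule inj0)
        show "w i \<in> carrier_vec n" "w' i \<in> carrier_vec n"
          using w that assms(2)[OF that] by auto
        show "w i @\<^sub>v 0\<^sub>v m = w' i @\<^sub>v 0\<^sub>v m"
          using fun_cong[OF eq, of i] that by (simp add: \<beta>_def)
      qed
      then have "w = w'"
        using PiE_ext[OF w] by simp
      moreover have "u = u'"
        using fun_cong[OF eq, of k] append_vec_eq[of "0\<^sub>v n" n "0\<^sub>v n" u u'] by (simp add: \<beta>_def)
      ultimately show "w = w' \<and> u = u'"
        by simp
    qed
    show "\<beta> ` (?D \<times> ?C) = (\<Pi>\<^sub>E i \<in> {..<Suc k}. ?W' i)"
    proof
      show "\<beta> ` (?D \<times> ?C) \<subseteq> (\<Pi>\<^sub>E i \<in> {..<Suc k}. ?W' i)"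
      proof (clarify, intro PiE_I)
        fix w u i
        assume w: "w \<in> ?D" and u: "u \<in> ?C"
        show "\<beta> (w, u) i \<in> ?W' i" if "i \<in> {..<Suc k}"
          using that u PiE_mem[OF w, of i] by (simp add: \<beta>_def)
        show "\<beta> (w, u) i = undefined" if "i \<notin> {..<Suc k}"
          using that by (simp add: \<beta>_def)
      qed
      show "(\<Pi>\<^sub>E i \<in> {..<Suc k}. ?W' i) \<subseteq> \<beta> ` (?D \<times> ?C)"
      proof
        fix f
        assume f: "f \<in> (\<Pi>\<^sub>E i \<in> {..<Suc k}. ?W' i)"
        have "\<exists>v \<in> W i. f i = v @\<^sub>v 0\<^sub>v m" if "i < k" for i
          using PiE_mem[OF f, of i] that by auto
        then obtain w where w: "\<And>i. i < k \<Longrightarrow> w i \<in> W i" "\<And>i. i < k \<Longrightarrow> f i = w i @\<^sub>v 0\<^sub>v m"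
          by metis
        obtain u where u: "u \<in> ?C" "f k = 0\<^sub>v n @\<^sub>v u"
          using PiE_mem[OF f, of k] by auto
        have "f = \<beta> (restrict w {..<k}, u)"
        proof
          fix i
          consider "i < k" | "i = k" | "i \<notin> {..<Suc k}"
            by fastforce
          then show "f i = \<beta> (restrict w {..<k}, u) i"
          proof cases
            case 3
            then show ?thesis
              using PiE_arb[OF f] by (simp add: \<beta>_def)
          qed (simp_all add: \<beta>_def w(2) u(2))
        qed
        then show "f \<in> \<beta> ` (?D \<times> ?C)"
          using w(1) u(1) by (intro image_eqI[of _ _ "(restrict w {..<k}, u)"]) auto
      qed
    qed
  qed
  let ?sum = "\<lambda>w. \<Oplus>\<^bsub>module_vec TYPE(complex) n\<^esub> i \<in> {..<k}. w i"
  let ?sum' = "\<lambda>w. \<Oplus>\<^bsub>module_vec TYPE(complex) (n + m)\<^esub> i \<in> {..<Suc k}. w i"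
  have bij_sum: "bij_betw ?sum ?D (carrier_vec n)"
    using assms(1) by (simp add: direct_sum_of_def)
  have bij_append: "bij_betw (\<lambda>(v, u). v @\<^sub>v u) (carrier_vec n \<times> ?C) (carrier_vec (n + m))"
    by (rule bij_betw_byWitness[where f' = "\<lambda>v. (vec_first v n, vec_last v m)"])
      (auto simp: vec_first_def vec_last_def intro!: eq_vecI)
  have sum_\<beta>: "?sum' (\<beta> (w, u)) = ?sum w @\<^sub>v u" if w: "w \<in> ?D" and u: "u \<in> ?C" for w u
  proof -
    have wi: "w i \<in> carrier_vec n" if "i < k" for i
      using w that assms(2)[OF that] by auto
    have "?sum' (\<beta> (w, u)) = (\<beta> (w, u)) k + finsum W.V (\<beta> (w, u)) {..<k}"
      using wi u by (subst lessThan_Suc, subst W.M.finsum_insert) (auto simp: \<beta>_def)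
    also have "finsum W.V (\<beta> (w, u)) {..<k} = finsum W.V (\<lambda>i. w i @\<^sub>v 0\<^sub>v m) {..<k}"
      using wi by (intro W.M.finsum_cong') (auto simp: \<beta>_def)
    also have "\<dots> = ?sum w @\<^sub>v 0\<^sub>v m"
      using wi by (intro finsum_append_zero) auto
    also have "\<beta> (w, u) k + (?sum w @\<^sub>v 0\<^sub>v m) = ?sum w @\<^sub>v u"
    proof -
      have s: "?sum w \<in> carrier_vec n"
        using wi by (intro V.M.finsum_closed) auto
      then show ?thesis
        using append_vec_zero_add[OF s u] u by (simp add: \<beta>_def comm_add_vec[of _ "n + m"])
    qed
    finally show ?thesis .
  qed
  \<comment> \<open>Summing the old family and appending \<open>u\<close> is bijective and equals
    \<open>?sum'\<close> after \<open>\<beta>\<close>; cancelling the bijection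
    \<open>\<beta>\<close> leaves the claim.\<close>
  have "bij_betw ((\<lambda>(v, u). v @\<^sub>v u) \<circ> map_prod ?sum id) (?D \<times> ?C) (carrier_vec (n + m))"
    using bij_append bij_betw_map_prod[OF bij_sum bij_betw_id[of ?C]] by (intro bij_betw_trans)
  also have "?this \<longleftrightarrow> bij_betw (?sum' \<circ> \<beta>) (?D \<times> ?C) (carrier_vec (n + m))"
    using sum_\<beta> by (intro bij_betw_cong) auto
  also have "\<dots> \<longleftrightarrow> bij_betw ?sum' (\<Pi>\<^sub>E i \<in> {..<Suc k}. ?W' i) (carrier_vec (n + m))"
    using bij_betw_comp_iff[OF bij_\<beta>] by blast
  finally show ?thesis
    by (simp add: direct_sum_of_def)
qed

text \<open>Block diagonal matrices realise the sum of the listed representations, and repeated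
  entries become separate summands. The last conjunct records that the kernel of the sum lies in the
  kernel of every summand.\<close>

lemma (in group) direct_sum_of_irreducibles:
  assumes "\<And>d \<sigma>. (d, \<sigma>) \<in> set xs \<Longrightarrow>
    complex_representation G d \<sigma> \<and> irreducible_subrepresentation G d \<sigma> (carrier_vec d)"
  shows "\<exists>n \<rho>. complex_representation G n \<rho> \<and> has_irreducible_components G n \<rho> (length xs) \<and>
    (\<forall>g \<in> carrier G. \<rho> g = 1\<^sub>m n \<longrightarrow> (\<forall>(d, \<sigma>) \<in> set xs. \<sigma> g = 1\<^sub>m d))"
  using assms
proof (induction xs)
  case Nil
  interpret V: vec_space "TYPE(complex)" 0 .
  have "complex_representation G 0 (\<lambda>_. 1\<^sub>m 0)"
    by (simp add: complex_representation_iff)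
  \<comment> \<open>The empty family is the only one, and its sum is the only vector of the zero
    space.\<close>
  moreover have "direct_sum_of 0 0 W" for W
  proof -
    have "(carrier_vec 0 :: complex vec set) = {0\<^sub>v 0}"
      by auto
    then show ?thesis
      by (simp add: direct_sum_of_def bij_betw_def V.M.finsum_empty module_vec_simps)
  qed
  ultimately show ?case
    by (intro exI[of _ 0] exI[of _ "\<lambda>_. 1\<^sub>m 0"]) (simp add: has_irreducible_components_def)
next
  case (Cons x xs)
  obtain m \<tau> where x: "x = (m, \<tau>)"
    by fastforce
  have \<tau>: "complex_representation G m \<tau>" "irreducible_subrepresentation G m \<tau> (carrier_vec m)"
    using Cons.prems[of m \<tau>] x by auto
  obtain n \<rho> where \<rho>: "complex_representation G n \<rho>" "has_irreducible_components G n \<rho> (length xs)"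
    "\<forall>g \<in> carrier G. \<rho> g = 1\<^sub>m n \<longrightarrow> (\<forall>(d, \<sigma>) \<in> set xs. \<sigma> g = 1\<^sub>m d)"
    using Cons.IH Cons.prems by (meson list.set_intros(2))
  obtain W where W: "\<And>i. i < length xs \<Longrightarrow> irreducible_subrepresentation G n \<rho> (W i)" "direct_sum_of n (length xs) W"
    using \<rho>(2) by (auto simp: has_irreducible_components_def)
  have c: "\<And>g. g \<in> carrier G \<Longrightarrow> \<rho> g \<in> carrier_mat n n" "\<And>g. g \<in> carrier G \<Longrightarrow> \<tau> g \<in> carrier_mat m m"
    using \<rho>(1) \<tau>(1) by (auto simp: complex_representation_iff)
  \<comment> \<open>The head of the list occupies the lower right block, hence the last
    summand.\<close>
  define \<phi> where "\<phi> g = four_block_mat (\<rho> g) (0\<^sub>m n m) (0\<^sub>m m n) (\<tau> g)" for g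
  have "complex_representation G (n + m) \<phi>"
    unfolding complex_representation_iff
  proof (intro conjI ballI)
    fix g
    assume "g \<in> carrier G"
    then show "\<phi> g \<in> carrier_mat (n + m) (n + m)"
      unfolding \<phi>_def by (intro four_block_carrier_mat c)
  next
    fix g h
    assume gh: "g \<in> carrier G" "h \<in> carrier G"
    note cc = c[OF gh(1)] c[OF gh(2)]
    have "\<phi> g * \<phi> h = four_block_mat (\<rho> g * \<rho> h) (0\<^sub>m n m) (0\<^sub>m m n) (\<tau> g * \<tau> h)"
      unfolding \<phi>_def using cc
      by (subst mult_four_block_mat[of _ n n _ m _ m _ _ n _ m]) simp_all
    then show "\<phi> (g \<otimes> h) = \<phi> g * \<phi> h"
      using gh \<rho>(1) \<tau>(1) by (simp add: \<phi>_def complex_representation_iff)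
  next
    show "\<phi> \<one> = 1\<^sub>m (n + m)"
      using \<rho>(1) \<tau>(1) by (simp add: \<phi>_def complex_representation_iff)
  qed
  moreover have "has_irreducible_components G (n + m) \<phi> (length (x # xs))"
  proof -
    let ?W = "\<lambda>i. if i < length xs then (\<lambda>v. v @\<^sub>v 0\<^sub>v m) ` W i else (\<lambda>v. 0\<^sub>v n @\<^sub>v v) ` carrier_vec m"
    have act: "\<phi> g *\<^sub>v (v @\<^sub>v w) = (\<rho> g *\<^sub>v v) @\<^sub>v (\<tau> g *\<^sub>v w)"
      if "g \<in> carrier G" "v \<in> carrier_vec n" "w \<in> carrier_vec m" for g v w
      unfolding \<phi>_def by (rule mult_mat_vec_split) (use that c in auto)
    have "irreducible_subrepresentation G (n + m) \<phi> (?W i)" if "i < Suc (length xs)" for i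
    proof (cases "i < length xs")
      case True
      have "irreducible_subrepresentation G (n + m) \<phi> ((\<lambda>v. v @\<^sub>v 0\<^sub>v m) ` W i)"
      proof (rule irreducible_subrepresentation_image[OF _ _ _ _ c(1) _ W(1)[OF True]])
        show "inj_on (\<lambda>v. v @\<^sub>v 0\<^sub>v m) (carrier_vec n)"
          by (auto simp: inj_on_def append_vec_eq)
      next
        fix v w :: "complex vec"
        assume "v \<in> carrier_vec n" "w \<in> carrier_vec n"
        then show "(v + w) @\<^sub>v 0\<^sub>v m = (v @\<^sub>v 0\<^sub>v m) + (w @\<^sub>v 0\<^sub>v m)"
          by (subst append_vec_add[of _ n _ _ m]) simp_all
      next
        fix g and v :: "complex vec"
        assume g: "g \<in> carrier G" and v: "v \<in> carrier_vec n"
        have "\<tau> g *\<^sub>v 0\<^sub>v m = 0\<^sub>v m"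
          using c(2)[OF g] by (intro eq_vecI) auto
        then show "\<phi> g *\<^sub>v (v @\<^sub>v 0\<^sub>v m) = (\<rho> g *\<^sub>v v) @\<^sub>v 0\<^sub>v m"
          using act[OF g v, of "0\<^sub>v m"] by simp
      qed (auto intro!: eq_vecI)
      with True show ?thesis
        by simp
    next
      case False
      have "irreducible_subrepresentation G (n + m) \<phi> ((\<lambda>v. 0\<^sub>v n @\<^sub>v v) ` carrier_vec m)"
      proof (rule irreducible_subrepresentation_image[OF _ _ _ _ c(2) _ \<tau>(2)])
        show "inj_on (\<lambda>v. 0\<^sub>v n @\<^sub>v v) (carrier_vec m)"
          by (auto simp: inj_on_def append_vec_eq[OF zero_carrier_vec zero_carrier_vec])
      next
        fix v w :: "complex vec"
        assume "v \<in> carrier_vec m" "w \<in> carrier_vec m"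
        then show "0\<^sub>v n @\<^sub>v (v + w) = (0\<^sub>v n @\<^sub>v v) + (0\<^sub>v n @\<^sub>v w)"
          by (subst append_vec_add[of _ n _ _ m]) simp_all
      next
        fix g and v :: "complex vec"
        assume g: "g \<in> carrier G" and v: "v \<in> carrier_vec m"
        have "\<rho> g *\<^sub>v 0\<^sub>v n = 0\<^sub>v n"
          using c(1)[OF g] by (intro eq_vecI) auto
        then show "\<phi> g *\<^sub>v (0\<^sub>v n @\<^sub>v v) = 0\<^sub>v n @\<^sub>v (\<tau> g *\<^sub>v v)"
          using act[OF g _ v, of "0\<^sub>v n"] by simp
      qed (auto intro!: eq_vecI)
      with False show ?thesis
        by simp
    qed
    moreover have "direct_sum_of (n + m) (Suc (length xs)) ?W"
      using W(1) by (intro direct_sum_of_append W(2))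
        (simp add: irreducible_subrepresentation_def subrepresentation_def subspace_module_vec_iff)
    ultimately show ?thesis
      unfolding has_irreducible_components_def list.size by (intro exI[of _ ?W]) simp
  qed
  moreover have "\<forall>(d, \<sigma>) \<in> set (x # xs). \<sigma> g = 1\<^sub>m d" if g: "g \<in> carrier G" and one: "\<phi> g = 1\<^sub>m (n + m)" for g
  proof -
    have "\<rho> g $$ (i, j) = 1\<^sub>m n $$ (i, j)" if "i < n" "j < n" for i j
      using arg_cong[OF one, of "\<lambda>A. A $$ (i, j)"] that c[OF g] by (simp add: \<phi>_def)
    then have "\<rho> g = 1\<^sub>m n"
      using c(1)[OF g] by (intro eq_matI) auto
    have "\<tau> g $$ (i, j) = 1\<^sub>m m $$ (i, j)" if "i < m" "j < m" for i j
      using arg_cong[OF one, of "\<lambda>A. A $$ (i + n, j + n)"] that c[OF g] by (simp add: \<phi>_def)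
    then have "\<tau> g = 1\<^sub>m m"
      using c(2)[OF g] by (intro eq_matI) auto
    with \<open>\<rho> g = 1\<^sub>m n\<close> \<rho>(3) g x show ?thesis
      by auto
  qed
  ultimately show ?case
    by blast
qed

section \<open>Faithfulness\<close>

text \<open>The weighted sum of averages is linear in the function averaged. It is nonzero on the
  regular character, hence on some irreducible constituent, to which the kernel argument
  applies.\<close>

lemma (in group) irreducible_separating_link:
  assumes "finite (carrier G)" "subgroup L G" "subgroup K G" "L \<subseteq> K"
    and "dual_totient L (G\<lparr>carrier := K\<rparr>) \<noteq> 0"
  shows "\<exists>d \<sigma>. complex_representation G d \<sigma> \<and> irreducible_subrepresentation G d \<sigma> (carrier_vec d) \<and>
    (\<forall>k \<in> K. \<sigma> k = 1\<^sub>m d \<longrightarrow> k \<in> L)"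
proof -
  obtain \<rho> where \<rho>: "complex_representation G (card (carrier G)) \<rho>"
    "\<And>g. g \<in> carrier G \<Longrightarrow> mat_trace (\<rho> g) = (if g = \<one> then of_nat (card (carrier G)) else 0)"
    using regular_representation[OF assms(1)] by blast
  obtain xs where xs: "\<And>d \<sigma>. (d, \<sigma>) \<in> set xs \<Longrightarrow>
      complex_representation G d \<sigma> \<and> irreducible_subrepresentation G d \<sigma> (carrier_vec d)"
    "\<And>g. g \<in> carrier G \<Longrightarrow> mat_trace (\<rho> g) = (\<Sum>(d, \<sigma>) \<leftarrow> xs. mat_trace (\<sigma> g))"
    using character_sum_irreducibles[OF \<rho>(1)] by blast
  define P where "P = subgroup_interval L (G\<lparr>carrier := K\<rparr>)"
  define \<mu> where "\<mu> M = (of_int (moebius P L M) :: complex)" for M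
  define S where "S f = (\<Sum>M \<in> P. \<mu> M * ((\<Sum>m \<in> M. f m) / of_nat (card M)))" for f :: "'a \<Rightarrow> complex"
  have P: "subgroup M G" "M \<subseteq> carrier G" if "M \<in> P" for M
  proof -
    show "subgroup M G"
      using that subgroup_interval_restrict[OF is_group assms(3), of L] by (simp add: P_def)
    then show "M \<subseteq> carrier G"
      by (rule subgroup.subset)
  qed
  have "finite K"
    by (rule finite_subset[OF subgroup.subset[OF assms(3)] assms(1)])
  have "S (\<lambda>g. mat_trace (\<rho> g)) = (\<Sum>M \<in> P. \<mu> M * (of_nat (card (carrier G)) / of_nat (card M)))"
    unfolding S_def
  proof (rule sum.cong)
    fix M
    assume M: "M \<in> P"
    have "finite M"
      using P(2)[OF M] assms(1) finite_subset by blast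
    \<comment> \<open>The regular character vanishes off the identity, so only one term
      survives.\<close>
    have "(\<Sum>m \<in> M. mat_trace (\<rho> m)) = (\<Sum>m \<in> M. if m = \<one> then of_nat (card (carrier G)) else 0)"
      using P(2)[OF M] \<rho>(2) by (intro sum.cong) auto
    also have "\<dots> = of_nat (card (carrier G))"
      using \<open>finite M\<close> subgroup.one_closed[OF P(1)[OF M]] by simp
    finally show "\<mu> M * ((\<Sum>m \<in> M. mat_trace (\<rho> m)) / of_nat (card M)) =
        \<mu> M * (of_nat (card (carrier G)) / of_nat (card M))"
      by simp
  qed simp
  also have "\<dots> = of_nat (card (carrier G)) / of_nat (card K) * of_int (dual_totient L (G\<lparr>carrier := K\<rparr>))"
    unfolding \<mu>_def P_def using sum_moebius_index[OF is_group assms(1,2,3)] .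
  also have "\<dots> \<noteq> 0"
    using assms(1,5) \<open>finite K\<close> subgroup.one_closed[OF assms(3)] one_closed by auto
  finally have "S (\<lambda>g. mat_trace (\<rho> g)) \<noteq> 0" .
  also have "S (\<lambda>g. mat_trace (\<rho> g)) = S (\<lambda>g. \<Sum>(d, \<sigma>) \<leftarrow> xs. mat_trace (\<sigma> g))"
    unfolding S_def using P(2) xs(2) by (intro sum.cong refl arg_cong2[where f = "(*)"] arg_cong2[where f = "(/)"]) auto
  also have "\<dots> = (\<Sum>(d, \<sigma>) \<leftarrow> xs. S (\<lambda>g. mat_trace (\<sigma> g)))"
  proof -
    have "S (\<lambda>g. \<Sum>(d, \<sigma>) \<leftarrow> ys. mat_trace (\<sigma> g)) = (\<Sum>(d, \<sigma>) \<leftarrow> ys. S (\<lambda>g. mat_trace (\<sigma> g)))"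
      for ys :: "(nat \<times> ('a \<Rightarrow> complex mat)) list"
      by (induction ys)
        (auto simp: S_def sum.distrib add_divide_distrib distrib_left split: prod.split)
    then show ?thesis .
  qed
  finally have nonzero: "(\<Sum>(d, \<sigma>) \<leftarrow> xs. S (\<lambda>g. mat_trace (\<sigma> g))) \<noteq> 0" .
  have "\<exists>d \<sigma>. (d, \<sigma>) \<in> set xs \<and> S (\<lambda>g. mat_trace (\<sigma> g)) \<noteq> 0"
  proof (rule ccontr)
    assume "\<not> ?thesis"
    then have "(\<Sum>(d, \<sigma>) \<leftarrow> xs. S (\<lambda>g. mat_trace (\<sigma> g))) = (\<Sum>_ \<leftarrow> xs. 0)"
      by (intro arg_cong[where f = sum_list] map_cong refl) auto
    with nonzero show False
      by simp
  qed
  then obtain d \<sigma> where \<sigma>: "(d, \<sigma>) \<in> set xs" "S (\<lambda>g. mat_trace (\<sigma> g)) \<noteq> 0"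
    by blast
  have "k \<in> L" if "k \<in> K" "\<sigma> k = 1\<^sub>m d" for k
  proof (rule kernel_subset_bottom[OF is_group _ _ assms(2,3,4) \<open>finite K\<close>])
    show "group (units_of (ring_mat TYPE(complex) d ()))"
      using ring_mat[where n = d and b = "()"] by (intro monoid.units_group) (rule ring.is_monoid)
    show "\<sigma> \<in> hom G (units_of (ring_mat TYPE(complex) d ()))"
      using xs(1)[OF \<sigma>(1)] by (simp add: complex_representation_def)
    show "\<sigma> k = \<one>\<^bsub>units_of (ring_mat TYPE(complex) d ())\<^esub>"
      using that by (simp add: units_of_def ring_mat_simps)
    show "(\<Sum>M \<in> subgroup_interval L (G\<lparr>carrier := K\<rparr>).
       of_int (moebius (subgroup_interval L (G\<lparr>carrier := K\<rparr>)) L M)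
         * ((\<Sum>m \<in> M. mat_trace (\<sigma> m)) / of_nat (card M))) \<noteq> 0"
      using \<sigma>(2) by (simp add: S_def \<mu>_def P_def)
  qed fact
  with xs(1)[OF \<sigma>(1)] show ?thesis
    by blast
qed

theorem corollary3p29:
  fixes G :: "('a, 'b) monoid_scheme"
  assumes "group G" and "finite (carrier G)"
  shows "min_faithful_components G \<le> chain_length {\<one>\<^bsub>G\<^esub>} G"
proof -
  interpret group G by fact
  define n where "n = chain_length {\<one>\<^bsub>G\<^esub>} G"
  \<comment> \<open>A chain attaining the minimal length, so that \<open>n\<close> links give
    \<open>n\<close> components.\<close>
  obtain C where "totient_chain {\<one>\<^bsub>G\<^esub>} G n C"
    using LeastI_ex[OF totient_chain_exists[OF assms(2)]] unfolding n_def chain_length_def by blast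
  then have C: "C 0 = {\<one>\<^bsub>G\<^esub>}" "C n = carrier G" "\<And>i. i \<le> n \<Longrightarrow> subgroup (C i) G"
    and links: "\<forall>i \<in> {1..n}. C (i - 1) \<subseteq> C i \<and> dual_totient (C (i - 1)) (G\<lparr>carrier := C i\<rparr>) \<noteq> 0"
    by (simp_all add: totient_chain_def)
  have link: "C i \<subseteq> C (Suc i)" "dual_totient (C i) (G\<lparr>carrier := C (Suc i)\<rparr>) \<noteq> 0" if "i < n" for i
    using bspec[OF links, of "Suc i"] that by simp_all
  have "\<exists>d \<sigma>. complex_representation G d \<sigma> \<and> irreducible_subrepresentation G d \<sigma> (carrier_vec d) \<and>
      (\<forall>k \<in> C (Suc i). \<sigma> k = 1\<^sub>m d \<longrightarrow> k \<in> C i)" if "i < n" for i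
    using irreducible_separating_link[OF assms(2), of "C i" "C (Suc i)"] C(3) link[OF that] that by simp
  then obtain d \<sigma> where \<sigma>: "\<And>i. i < n \<Longrightarrow> complex_representation G (d i) (\<sigma> i)"
    "\<And>i. i < n \<Longrightarrow> irreducible_subrepresentation G (d i) (\<sigma> i) (carrier_vec (d i))"
    "\<And>i k. i < n \<Longrightarrow> k \<in> C (Suc i) \<Longrightarrow> \<sigma> i k = 1\<^sub>m (d i) \<Longrightarrow> k \<in> C i"
    by metis
  define xs where "xs = map (\<lambda>i. (d i, \<sigma> i)) [0..<n]"
  have "complex_representation G e \<tau> \<and> irreducible_subrepresentation G e \<tau> (carrier_vec e)"
    if "(e, \<tau>) \<in> set xs" for e \<tau>
    using that \<sigma>(1,2) by (auto simp: xs_def)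
  then obtain N \<rho> where \<rho>: "complex_representation G N \<rho>" "has_irreducible_components G N \<rho> (length xs)"
    "\<And>g. g \<in> carrier G \<Longrightarrow> \<rho> g = 1\<^sub>m N \<Longrightarrow> \<forall>(e, \<tau>) \<in> set xs. \<tau> g = 1\<^sub>m e"
    using direct_sum_of_irreducibles[of xs] by blast
  have kernel: "g = \<one>\<^bsub>G\<^esub>" if g: "g \<in> carrier G" "\<rho> g = 1\<^sub>m N" for g
  proof -
    have trivial: "\<sigma> i g = 1\<^sub>m (d i)" if "i < n" for i
      using \<rho>(3)[OF g] that by (auto simp: xs_def)
    \<comment> \<open>Descent from \<open>C n = carrier G\<close>: in the \<open>i\<close>-th link,
      triviality of \<open>\<sigma> i g\<close> moves \<open>g\<close> from \<open>C (Suc i)\<close>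
      into \<open>C i\<close>.\<close>
    have "g \<in> C 0"
      by (rule inc_induct[of 0 n "\<lambda>i. g \<in> C i"]) (use g C(2) \<sigma>(3) trivial in auto)
    then show ?thesis
      using C(1) by simp
  qed
  have "inj_on \<rho> (carrier G)"
  proof (rule inj_onI)
    fix g h
    assume gh: "g \<in> carrier G" "h \<in> carrier G" and eq: "\<rho> g = \<rho> h"
    \<comment> \<open>Equal images put \<open>g\<close> times the inverse of \<open>h\<close> into
      the kernel, which is trivial.\<close>
    have "\<rho> (g \<otimes>\<^bsub>G\<^esub> inv\<^bsub>G\<^esub> h) = \<rho> (h \<otimes>\<^bsub>G\<^esub> inv\<^bsub>G\<^esub> h)"
      using \<rho>(1) gh eq unfolding complex_representation_iff by (metis inv_closed)
    also have "\<dots> = 1\<^sub>m N"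
      using \<rho>(1) r_inv[OF gh(2)] by (simp only: complex_representation_iff)
    finally have "\<rho> (g \<otimes>\<^bsub>G\<^esub> inv\<^bsub>G\<^esub> h) = 1\<^sub>m N" .
    then have "g \<otimes>\<^bsub>G\<^esub> inv\<^bsub>G\<^esub> h = \<one>\<^bsub>G\<^esub>"
      using kernel gh by simp
    then show "g = h"
      using gh by (metis inv_closed inv_equality inv_inv)
  qed
  with \<rho>(1,2) have "\<exists>N \<rho>. faithful_representation G N \<rho> \<and> has_irreducible_components G N \<rho> n"
    unfolding faithful_representation_def by (auto simp: xs_def)
  then show ?thesis
    unfolding min_faithful_components_def n_def by (rule Least_le)
qed

end
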